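(* Let $X$ be a path-connected space that has a finite covering $X=\bigcup_{i=1}^n U_i$ such that $U_1,\ldots,U_n$ are Borel-measurable sets and the closures $\overline U_1,\ldots,\overline U_n$ are compact and contractible in $X$. Then for any $x_0\in X$ there is a chain map $\eta_*\colon\mathcal C_*(X)\to\mathcal C_*^{x_0}(X)$ such that $\eta\iota=\mathrm{id}$, and a chain homotopy $s_*\colon\mathcal C_*(X)\to\mathcal C_{*+1}(X)$ such that $\partial s+s\partial=\iota\eta-\mathrm{id}$, where $\iota\colon\mathcal C_*^{x_0}(X)\to\mathcal C_*(X)$ is the inclusion.
   Context: $map(\Delta^k,X)$ is the set of singular $k$-simplices with the compact-open topology and its Borel $\sigma$-algebra. $\mathcal C_k(X)$ is the real vector space of signed measures $\mu$ on $map(\Delta^k,X)$ that are compactly determined (there is a compact, not necessarily measurable or Hausdorff, set such that $\mu$ vanishes on every measurable subset of its complement) and have finite variation $\|\mu\|=\max_A\mu(A)-\min_B\mu(B)<\infty$; the boundary operator $\partial=\sum_i(-1)^i\partial^i$ is induced by push-forward along the face maps. $S_k^{x_0}(X)$ is the set of singular $k$-simplices mapping all vertices of $\Delta^k$ to $x_0$. $\mathcal C_*^{x_0}(X)\subset\mathcal C_*(X)$ is the subcomplex of those measures that vanish on each measurable subset of the complement of $S_*^{x_0}(X)$. A subset $A\subset X$ is contractible in $X$ if its inclusion into $X$ is homotopic (in $X$) to a constant map. *)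

theory Defs
  imports "HOL-Analysis.Analysis" "HOL-Homology.Homology"
begin

(* The subbasic set for K = {} and U = topspace X is the whole mapping set, so this is a
   topology on the set of all continuous maps Y -> X (made extensional outside topspace Y). *)
definition compact_open_topology ::
    "'a topology \<Rightarrow> 'b topology \<Rightarrow> ('a \<Rightarrow> 'b) topology" where
  "compact_open_topology Y X =
     topology_generated_by
       {{f. continuous_map Y X f \<and> f \<in> extensional (topspace Y) \<and> f ` K \<subseteq> U} | K U.
          compactin Y K \<and> openin X U}"

definition simplex_space :: "nat \<Rightarrow> 'a topology \<Rightarrow> ((nat \<Rightarrow> real) \<Rightarrow> 'a) topology" where
  "simplex_space k X =
     compact_open_topology (subtopology (powertop_real UNIV) (standard_simplex k)) X"

lemma topspace_compact_open_topology:
  "topspace (compact_open_topology Y X) =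
     {f. continuous_map Y X f \<and> f \<in> extensional (topspace Y)}"
proof -
  have "{f. continuous_map Y X f \<and> f \<in> extensional (topspace Y)} \<in>
      {{f. continuous_map Y X f \<and> f \<in> extensional (topspace Y) \<and> f ` K \<subseteq> U} | K U.
          compactin Y K \<and> openin X U}"
    by (intro CollectI exI[of _ "{}"] exI[of _ "topspace X"]) auto
  then show ?thesis
    unfolding compact_open_topology_def topology_generated_by_topspace by blast
qed

lemma topspace_simplex_space: "topspace (simplex_space k X) = singular_simplex_set k X"
  by (auto simp: simplex_space_def topspace_compact_open_topology singular_simplex_def
      topspace_standard_simplex)

(* Only the sigma-algebra matters here. *)
definition borel_space_of :: "'a topology \<Rightarrow> 'a measure" where
  "borel_space_of T = sigma (topspace T) {U. openin T U}"

lemma space_borel_space_of [simp]: "space (borel_space_of T) = topspace T"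
  unfolding borel_space_of_def by (rule space_measure_of) (auto dest: openin_subset)

lemma sets_borel_space_of: "sets (borel_space_of T) = sigma_sets (topspace T) {U. openin T U}"
  unfolding borel_space_of_def by (rule sets_measure_of) (auto dest: openin_subset)

abbreviation simplex_borel :: "nat \<Rightarrow> 'a topology \<Rightarrow> ((nat \<Rightarrow> real) \<Rightarrow> 'a) measure" where
  "simplex_borel k X \<equiv> borel_space_of (simplex_space k X)"

(* max_A \<mu>(A) - min_B \<mu>(B), with values in the extended reals. *)
definition measure_variation :: "'a measure \<Rightarrow> ('a set \<Rightarrow> real) \<Rightarrow> ereal" where
  "measure_variation M \<mu> =
     (SUP A\<in>sets M. ereal (\<mu> A)) - (INF B\<in>sets M. ereal (\<mu> B))"

(* A signed measure of finite variation takes only finite values, hence the codomain real.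
   The value 0 outside the sigma-algebra is a normalisation that makes equality of signed
   measures coincide with equality of functions. *)
definition finite_signed_measure :: "'a measure \<Rightarrow> ('a set \<Rightarrow> real) \<Rightarrow> bool" where
  "finite_signed_measure M \<mu> \<longleftrightarrow>
     \<mu> {} = 0 \<and>
     (\<forall>A :: nat \<Rightarrow> 'a set. range A \<subseteq> sets M \<longrightarrow> disjoint_family A \<longrightarrow>
        (\<lambda>n. \<mu> (A n)) sums \<mu> (\<Union>n. A n)) \<and>
     (\<forall>A. A \<notin> sets M \<longrightarrow> \<mu> A = 0) \<and>
     measure_variation M \<mu> < \<infinity>"

definition vanishes_off :: "'a measure \<Rightarrow> ('a set \<Rightarrow> real) \<Rightarrow> 'a set \<Rightarrow> bool" where
  "vanishes_off M \<mu> K \<longleftrightarrow> (\<forall>A\<in>sets M. A \<subseteq> space M - K \<longrightarrow> \<mu> A = 0)"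

type_synonym 'a measure_chain = "((nat \<Rightarrow> real) \<Rightarrow> 'a) set \<Rightarrow> real"

definition measure_chains :: "nat \<Rightarrow> 'a topology \<Rightarrow> 'a measure_chain set" where
  "measure_chains k X =
     {\<mu>. finite_signed_measure (simplex_borel k X) \<mu> \<and>
         (\<exists>K. compactin (simplex_space k X) K \<and> vanishes_off (simplex_borel k X) \<mu> K)}"

definition push_forward ::
    "'a measure \<Rightarrow> 'b measure \<Rightarrow> ('a \<Rightarrow> 'b) \<Rightarrow> ('a set \<Rightarrow> real) \<Rightarrow> 'b set \<Rightarrow> real" where
  "push_forward M N f \<mu> = (\<lambda>A. if A \<in> sets N then \<mu> (f -` A \<inter> space M) else 0)"

definition measure_boundary ::
    "nat \<Rightarrow> 'a topology \<Rightarrow> 'a measure_chain \<Rightarrow> 'a measure_chain" where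
  "measure_boundary k X \<mu> =
     (if k = 0 then (\<lambda>A. 0)
      else (\<lambda>A. \<Sum>i\<le>k. (-1) ^ i *
             push_forward (simplex_borel k X) (simplex_borel (k - 1) X)
               (singular_face k i) \<mu> A))"

definition based_simplices :: "nat \<Rightarrow> 'a topology \<Rightarrow> 'a \<Rightarrow> ((nat \<Rightarrow> real) \<Rightarrow> 'a) set" where
  "based_simplices k X x0 =
     {\<sigma>. singular_simplex k X \<sigma> \<and> (\<forall>i\<le>k. simplicial_vertex i \<sigma> = x0)}"

definition based_measure_chains :: "nat \<Rightarrow> 'a topology \<Rightarrow> 'a \<Rightarrow> 'a measure_chain set" where
  "based_measure_chains k X x0 =
     {\<mu> \<in> measure_chains k X. vanishes_off (simplex_borel k X) \<mu> (based_simplices k X x0)}"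

definition real_linear_between ::
    "('a \<Rightarrow> real) set \<Rightarrow> ('b \<Rightarrow> real) set \<Rightarrow> (('a \<Rightarrow> real) \<Rightarrow> ('b \<Rightarrow> real)) \<Rightarrow> bool" where
  "real_linear_between V W f \<longleftrightarrow>
     f \<in> V \<rightarrow> W \<and>
     (\<forall>\<mu>\<in>V. \<forall>\<nu>\<in>V. f (\<lambda>A. \<mu> A + \<nu> A) = (\<lambda>A. f \<mu> A + f \<nu> A)) \<and>
     (\<forall>c. \<forall>\<mu>\<in>V. f (\<lambda>A. c * \<mu> A) = (\<lambda>A. c * f \<mu> A))"

definition based_chain_map ::
    "'a topology \<Rightarrow> 'a \<Rightarrow> (nat \<Rightarrow> 'a measure_chain \<Rightarrow> 'a measure_chain) \<Rightarrow> bool" where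
  "based_chain_map X x0 \<eta> \<longleftrightarrow>
     (\<forall>k. real_linear_between (measure_chains k X) (based_measure_chains k X x0) (\<eta> k)) \<and>
     (\<forall>k. \<forall>\<mu>\<in>measure_chains (Suc k) X.
        measure_boundary (Suc k) X (\<eta> (Suc k) \<mu>) = \<eta> k (measure_boundary (Suc k) X \<mu>))"

(* \<partial> s + s \<partial> = f - g; the chain groups vanish in negative degrees, so the term s \<partial> is
   absent in degree 0. *)
definition measure_chain_homotopy ::
    "'a topology \<Rightarrow> (nat \<Rightarrow> 'a measure_chain \<Rightarrow> 'a measure_chain) \<Rightarrow>
     (nat \<Rightarrow> 'a measure_chain \<Rightarrow> 'a measure_chain) \<Rightarrow>
     (nat \<Rightarrow> 'a measure_chain \<Rightarrow> 'a measure_chain) \<Rightarrow> bool" where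
  "measure_chain_homotopy X f g s \<longleftrightarrow>
     (\<forall>k. real_linear_between (measure_chains k X) (measure_chains (Suc k) X) (s k)) \<and>
     (\<forall>\<mu>\<in>measure_chains 0 X.
        measure_boundary (Suc 0) X (s 0 \<mu>) = (\<lambda>A. f 0 \<mu> A - g 0 \<mu> A)) \<and>
     (\<forall>k. \<forall>\<mu>\<in>measure_chains (Suc k) X.
        (\<lambda>A. measure_boundary (Suc (Suc k)) X (s (Suc k) \<mu>) A +
              s k (measure_boundary (Suc k) X \<mu>) A) =
        (\<lambda>A. f (Suc k) \<mu> A - g (Suc k) \<mu> A))"

definition contractible_in :: "'a topology \<Rightarrow> 'a set \<Rightarrow> bool" where
  "contractible_in X A \<longleftrightarrow>
     (\<exists>c\<in>topspace X. homotopic_with (\<lambda>h. True) (subtopology X A) X id (\<lambda>x. c))"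

end

theory Submission
  imports Defs "HOL-Library.Function_Algebras"
begin

text \<open>Choosing the first \<open>U\<^sub>i\<close> that contains a point gives each point, in a Borel way with finitely many
  choices, a path to \<open>x\<^sub>0\<close>. Sliding the vertices of simplices along these paths is natural in the faces, and
  it is continuous on each of finitely many Borel pieces; so push-forward along the usual prism
  decomposition gives a chain homotopy \<open>G\<close> from the identity to a chain map \<open>F\<close> into the based chains, and
  \<open>G\<close> preserves the based chains. The point \<open>x\<^sub>0\<close> need not be a Borel set, so one cannot choose the constant
  path there. Instead, \<open>s = G (id - P)\<close> for linear projections \<open>P\<close> onto the based chains vanishes on based
  chains, and \<open>\<eta> = id + \<partial>s + s\<partial> = F - \<partial>GP - GP\<partial>\<close> takes values in based chains and is the identity there.\<close>

subsection \<open>Finite signed measures and push-forwards\<close>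

text \<open>The chosen paths start at the vertices only, so moving the vertices has to be extended
  over each simplex by a formula that respects faces and leaves no discontinuity inside a simplex.
  The explicit formula does this without induction on the dimension: a neighbourhood of each vertex
  is collapsed to that vertex, and the time left over (\<open>excess\<close>) is spent travelling
  along its path; where no time is left, only the squeezed simplex is seen. Both ingredients are
  symmetric in the coordinates and insensitive to inserted zeros, hence natural in faces.

  Compact determination is the second constraint. A Borel piece need not be closed, so its
  intersection with a compact set need not be compact. The formula of a piece therefore lives on a
  closed set containing it: there the vertices lie in prescribed closures, on which the contractions
  are still continuous.

  The projections \<open>P\<close> come from linear algebra alone. They are not push-forwards and
  are not asked to commute with the boundary. This is harmless because both \<open>G\<close> and the
  boundary preserve based chains, so every error term stays based.\<close>

lemma finite_signed_measure_iff_bounded: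
  "finite_signed_measure M \<mu> \<longleftrightarrow>
     \<mu> {} = 0 \<and>
     (\<forall>A :: nat \<Rightarrow> 'a set. range A \<subseteq> sets M \<longrightarrow> disjoint_family A \<longrightarrow>
        (\<lambda>n. \<mu> (A n)) sums \<mu> (\<Union>n. A n)) \<and>
     (\<forall>A. A \<notin> sets M \<longrightarrow> \<mu> A = 0) \<and>
     (\<exists>B. \<forall>A\<in>sets M. \<bar>\<mu> A\<bar> \<le> B)"
proof -
  have "measure_variation M \<mu> < \<infinity> \<longleftrightarrow> (\<exists>B. \<forall>A\<in>sets M. \<bar>\<mu> A\<bar> \<le> B)" if 0: "\<mu> {} = 0"
  proof
    let ?S = "SUP A\<in>sets M. ereal (\<mu> A)" and ?I = "INF A\<in>sets M. ereal (\<mu> A)"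
    assume fin: "measure_variation M \<mu> < \<infinity>"
    \<comment> \<open>The empty set puts 0 between infimum and supremum, so a finite difference
      forces both of them to be finite.\<close>
    have S0: "0 \<le> ?S" and I0: "?I \<le> 0"
      using 0 by (auto intro!: SUP_upper2[of "{}"] INF_lower2[of "{}"])
    have "?S \<noteq> \<infinity>" "?I \<noteq> -\<infinity>"
      using fin S0 I0 unfolding measure_variation_def by auto
    then obtain a b where a: "?S = ereal a" and b: "?I = ereal b"
      using S0 I0 by (cases ?S; cases ?I) auto
    have "\<bar>\<mu> A\<bar> \<le> \<bar>a\<bar> + \<bar>b\<bar>" if "A \<in> sets M" for A
    proof -
      have "ereal (\<mu> A) \<le> ?S" using that by (rule SUP_upper)
      then have "\<mu> A \<le> a" by (simp add: a)
      moreover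
      have "?I \<le> ereal (\<mu> A)" using that by (rule INF_lower)
      then have "b \<le> \<mu> A" by (simp add: b)
      ultimately show ?thesis by linarith
    qed
    then show "\<exists>B. \<forall>A\<in>sets M. \<bar>\<mu> A\<bar> \<le> B" by blast
  next
    assume "\<exists>B. \<forall>A\<in>sets M. \<bar>\<mu> A\<bar> \<le> B"
    then obtain B where B: "\<And>A. A \<in> sets M \<Longrightarrow> \<bar>\<mu> A\<bar> \<le> B" by blast
    have "(SUP A\<in>sets M. ereal (\<mu> A)) \<le> ereal B"
      using B by (intro SUP_least) (auto simp: abs_le_iff)
    moreover have "ereal (- B) \<le> (INF A\<in>sets M. ereal (\<mu> A))"
      using B by (intro INF_greatest) (fastforce simp: abs_le_iff)
    ultimately have "measure_variation M \<mu> \<le> ereal B - ereal (- B)"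
      unfolding measure_variation_def by (rule ereal_minus_mono)
    then show "measure_variation M \<mu> < \<infinity>"
      by (cases "measure_variation M \<mu>") auto
  qed
  then show ?thesis
    unfolding finite_signed_measure_def by blast
qed

lemma finite_signed_measure_zero: "finite_signed_measure M (\<lambda>A. 0)"
  unfolding finite_signed_measure_iff_bounded by auto

lemma finite_signed_measure_add:
  assumes "finite_signed_measure M \<mu>" "finite_signed_measure M \<nu>"
  shows "finite_signed_measure M (\<lambda>A. \<mu> A + \<nu> A)"
proof -
  obtain B C where B: "\<forall>A\<in>sets M. \<bar>\<mu> A\<bar> \<le> B" and C: "\<forall>A\<in>sets M. \<bar>\<nu> A\<bar> \<le> C"
    using assms unfolding finite_signed_measure_iff_bounded by blast
  have "\<forall>A\<in>sets M. \<bar>\<mu> A + \<nu> A\<bar> \<le> B + C"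
  proof
    fix A assume "A \<in> sets M"
    then have "\<bar>\<mu> A\<bar> \<le> B" "\<bar>\<nu> A\<bar> \<le> C" using B C by simp_all
    then show "\<bar>\<mu> A + \<nu> A\<bar> \<le> B + C" by linarith
  qed
  moreover have "(\<lambda>n. \<mu> (A n) + \<nu> (A n)) sums (\<mu> (\<Union>n. A n) + \<nu> (\<Union>n. A n))"
    if "range A \<subseteq> sets M" "disjoint_family A" for A :: "nat \<Rightarrow> 'a set"
    using assms that by (intro sums_add) (simp_all add: finite_signed_measure_def)
  moreover have "\<mu> {} + \<nu> {} = 0" "\<And>A. A \<notin> sets M \<Longrightarrow> \<mu> A + \<nu> A = 0"
    using assms by (simp_all add: finite_signed_measure_def)
  ultimately show ?thesis
    unfolding finite_signed_measure_iff_bounded by blast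
qed

lemma finite_signed_measure_cmult:
  assumes "finite_signed_measure M \<mu>"
  shows "finite_signed_measure M (\<lambda>A. c * \<mu> A)"
proof -
  obtain B where "\<forall>A\<in>sets M. \<bar>\<mu> A\<bar> \<le> B"
    using assms unfolding finite_signed_measure_iff_bounded by blast
  then have "\<forall>A\<in>sets M. \<bar>c * \<mu> A\<bar> \<le> \<bar>c\<bar> * B"
    by (auto simp: abs_mult mult_left_mono)
  moreover have "(\<lambda>n. c * \<mu> (A n)) sums (c * \<mu> (\<Union>n. A n))"
    if "range A \<subseteq> sets M" "disjoint_family A" for A :: "nat \<Rightarrow> 'a set"
    using assms that by (intro sums_mult) (simp add: finite_signed_measure_def)
  moreover have "c * \<mu> {} = 0" "\<And>A. A \<notin> sets M \<Longrightarrow> c * \<mu> A = 0"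
    using assms by (simp_all add: finite_signed_measure_def)
  ultimately show ?thesis
    unfolding finite_signed_measure_iff_bounded by blast
qed

lemma finite_signed_measure_push_forward:
  assumes \<mu>: "finite_signed_measure M \<mu>" and f: "f \<in> measurable M N"
  shows "finite_signed_measure N (push_forward M N f \<mu>)"
proof -
  have sets: "f -` A \<inter> space M \<in> sets M" if "A \<in> sets N" for A
    using f that by (rule measurable_sets)
  have "(\<lambda>n. push_forward M N f \<mu> (A n)) sums push_forward M N f \<mu> (\<Union>n. A n)"
    if A: "range A \<subseteq> sets N" "disjoint_family A" for A :: "nat \<Rightarrow> 'b set"
  proof -
    have "(\<lambda>n. \<mu> (f -` A n \<inter> space M)) sums \<mu> (\<Union>n. f -` A n \<inter> space M)"
      using \<mu> A sets unfolding finite_signed_measure_def disjoint_family_on_def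
      by (elim conjE allE[of _ "\<lambda>n. f -` A n \<inter> space M"]) blast
    moreover have "(\<Union>n. f -` A n \<inter> space M) = f -` (\<Union>n. A n) \<inter> space M" by blast
    moreover have "(\<Union>n. A n) \<in> sets N" "\<And>n. A n \<in> sets N" using A by auto
    ultimately show ?thesis by (simp add: push_forward_def)
  qed
  moreover have "\<exists>B. \<forall>A\<in>sets N. \<bar>push_forward M N f \<mu> A\<bar> \<le> B"
  proof -
    obtain B where "\<And>A. A \<in> sets M \<Longrightarrow> \<bar>\<mu> A\<bar> \<le> B"
      using \<mu> unfolding finite_signed_measure_iff_bounded by blast
    then show ?thesis
      using sets by (intro exI[of _ B]) (simp add: push_forward_def)
  qed
  ultimately show ?thesis
    using \<mu> unfolding finite_signed_measure_iff_bounded by (auto simp: push_forward_def)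
qed

lemma push_forward_compose:
  assumes "f \<in> measurable M N" "g \<in> measurable N P"
  shows "push_forward N P g (push_forward M N f \<mu>) = push_forward M P (g \<circ> f) \<mu>"
proof
  fix A
  have "f -` (g -` A \<inter> space N) \<inter> space M = (g \<circ> f) -` A \<inter> space M"
    using measurable_space[OF assms(1)] by auto
  then show "push_forward N P g (push_forward M N f \<mu>) A = push_forward M P (g \<circ> f) \<mu> A"
    using measurable_sets[OF assms(2)] by (simp add: push_forward_def)
qed

lemma push_forward_cong:
  assumes "\<And>x. x \<in> space M \<Longrightarrow> f x = g x"
  shows "push_forward M N f \<mu> = push_forward M N g \<mu>"
proof -
  have "f -` A \<inter> space M = g -` A \<inter> space M" for A using assms by auto
  then show ?thesis unfolding push_forward_def by presburger
qed

lemma push_forward_sum: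
  "push_forward M N f (\<lambda>A. \<Sum>i\<in>I. c i * \<mu> i A) = (\<lambda>A. \<Sum>i\<in>I. c i * push_forward M N f (\<mu> i) A)"
  by (auto simp: push_forward_def)

text \<open>Equality on all sets, not only measurable ones: off the sigma-algebra both sides are 0
  by the normalisation of signed measures.\<close>

lemma push_forward_id:
  assumes "finite_signed_measure M \<mu>" "\<And>x. x \<in> space M \<Longrightarrow> f x = x"
  shows "push_forward M M f \<mu> = \<mu>"
proof
  fix A
  have "f -` A \<inter> space M = A" if "A \<in> sets M"
    using assms(2) sets.sets_into_space[OF that] by auto
  then show "push_forward M M f \<mu> A = \<mu> A"
    using assms(1) by (auto simp: push_forward_def finite_signed_measure_def)
qed

subsection \<open>Maps that induce operators on measure chains\<close>

text \<open>The first clause lets a measure be pushed forward, the second keeps it compactly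
  determined. A compact superset \<open>L\<close> is requested because a piecewise continuous image
  of a compact set need not be compact.\<close>

definition compact_borel_map :: "'a topology \<Rightarrow> 'b topology \<Rightarrow> ('a \<Rightarrow> 'b) \<Rightarrow> bool" where
  "compact_borel_map T S f \<longleftrightarrow>
     f \<in> measurable (borel_space_of T) (borel_space_of S) \<and>
     (\<forall>K. compactin T K \<longrightarrow> (\<exists>L. compactin S L \<and> f ` K \<subseteq> L))"

lemma openin_imp_sets_borel: "openin T U \<Longrightarrow> U \<in> sets (borel_space_of T)"
  by (auto simp: sets_borel_space_of)

lemma closedin_imp_sets_borel:
  assumes "closedin T D" shows "D \<in> sets (borel_space_of T)"
proof -
  have "topspace T - (topspace T - D) \<in> sets (borel_space_of T)"
    using assms by (metis openin_imp_sets_borel closedin_def sets.compl_sets space_borel_space_of)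
  then show ?thesis
    using closedin_subset[OF assms] by (simp add: double_diff)
qed

text \<open>The preimage of an open set is relatively open in \<open>D\<close>, hence Borel in
  \<open>T\<close> because \<open>D\<close> is closed. Since open sets generate, this carries over
  to all Borel sets.\<close>

lemma continuous_map_preimage_sets_borel:
  assumes D: "closedin T D" and g: "continuous_map (subtopology T D) S g"
    and A: "A \<in> sets (borel_space_of S)"
  shows "g -` A \<inter> D \<in> sets (borel_space_of T)"
proof -
  let ?M = "restrict_space (borel_space_of T) D"
  have sp: "space ?M = D"
    using closedin_subset[OF D] by (auto simp: space_restrict_space)
  have "g \<in> measurable ?M (borel_space_of S)"
    unfolding borel_space_of_def[of S]
  proof (rule measurable_measure_of)
    show "{U. openin S U} \<subseteq> Pow (topspace S)" by (auto dest: openin_subset)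
    show "g \<in> space ?M \<rightarrow> topspace S"
      using g closedin_subset[OF D] by (auto simp: continuous_map_def sp)
    fix U assume "U \<in> {U. openin S U}"
    then have "openin (subtopology T D) {x \<in> topspace (subtopology T D). g x \<in> U}"
      using g by (auto simp: continuous_map_def)
    then obtain V where V: "openin T V" "{x \<in> topspace (subtopology T D). g x \<in> U} = V \<inter> D"
      by (auto simp: openin_subtopology)
    have "g -` U \<inter> D = V \<inter> D"
      using V(2) closedin_subset[OF D] by auto
    then have "g -` U \<inter> D \<in> sets (borel_space_of T)"
      using V(1) D by (simp add: closedin_imp_sets_borel openin_imp_sets_borel sets.Int)
    then show "g -` U \<inter> space ?M \<in> sets ?M"
      using closedin_imp_sets_borel[OF D] unfolding sp
      by (subst sets_restrict_space_iff) (auto simp: Int_absorb2 closedin_subset[OF D])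
  qed
  then have "g -` A \<inter> D \<in> sets ?M"
    using A measurable_sets sp by metis
  then show ?thesis
    using closedin_imp_sets_borel[OF D]
    by (subst (asm) sets_restrict_space_iff) (auto simp: Int_absorb2 closedin_subset[OF D])
qed

text \<open>The two families share the work: the Borel sets \<open>E j\<close> give measurability,
  the closed sets \<open>D j\<close> give compactness, because \<open>K \<inter> D j\<close> is
  compact whenever \<open>K\<close> is. The compact superset is the finite union of the images of
  these intersections.\<close>

lemma compact_borel_map_piecewise:
  assumes fin: "finite J"
    and E: "\<And>j. j \<in> J \<Longrightarrow> E j \<in> sets (borel_space_of T)"
    and cover: "topspace T \<subseteq> (\<Union>j\<in>J. E j)"
    and ED: "\<And>j. j \<in> J \<Longrightarrow> E j \<subseteq> D j"
    and D: "\<And>j. j \<in> J \<Longrightarrow> closedin T (D j)"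
    and g: "\<And>j. j \<in> J \<Longrightarrow> continuous_map (subtopology T (D j)) S (g j)"
    and f: "\<And>j x. j \<in> J \<Longrightarrow> x \<in> E j \<Longrightarrow> f x = g j x"
  shows "compact_borel_map T S f"
  unfolding compact_borel_map_def
proof (intro conjI allI impI measurableI)
  fix x assume "x \<in> space (borel_space_of T)"
  then obtain j where "j \<in> J" "x \<in> E j" using cover by auto
  then show "f x \<in> space (borel_space_of S)"
    using f[of j x] g[of j] ED[of j] closedin_subset[OF D, of j]
    by (auto simp: continuous_map_def Pi_iff)
next
  fix A assume A: "A \<in> sets (borel_space_of S)"
  have "f -` A \<inter> topspace T = (\<Union>j\<in>J. E j \<inter> (g j -` A \<inter> D j))" (is "?l = ?r")
  proof
    show "?l \<subseteq> ?r"
    proof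
      fix x assume x: "x \<in> ?l"
      then obtain j where "j \<in> J" "x \<in> E j" using cover by auto
      then show "x \<in> ?r" using x f[of j x] ED[of j] by auto
    qed
    show "?r \<subseteq> ?l" using f closedin_subset[OF D] by fastforce
  qed
  also have "\<dots> \<in> sets (borel_space_of T)"
    using fin E continuous_map_preimage_sets_borel[OF D g A] by (intro sets.finite_UN) auto
  finally show "f -` A \<inter> space (borel_space_of T) \<in> sets (borel_space_of T)" by simp
next
  fix K assume K: "compactin T K"
  define L where "L = (\<Union>j\<in>J. g j ` (K \<inter> D j))"
  have "compactin S (g j ` (K \<inter> D j))" if "j \<in> J" for j
  proof (rule image_compactin[OF _ g[OF that]])
    show "compactin (subtopology T (D j)) (K \<inter> D j)"
      using K D[OF that] by (simp add: compactin_subtopology compact_Int_closedin)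
  qed
  then have "compactin S L" unfolding L_def using fin by (intro compactin_Union) auto
  moreover have "f ` K \<subseteq> L"
  proof
    fix y assume "y \<in> f ` K"
    then obtain x where x: "x \<in> K" "y = f x" by auto
    then obtain j where "j \<in> J" "x \<in> E j" using cover compactin_subset_topspace[OF K] by auto
    then show "y \<in> L" using x f[of j x] ED[of j] by (auto simp: L_def)
  qed
  ultimately show "\<exists>L. compactin S L \<and> f ` K \<subseteq> L" by blast
qed

lemma continuous_imp_compact_borel_map:
  assumes "continuous_map T S f"
  shows "compact_borel_map T S f"
proof (rule compact_borel_map_piecewise[where J = "{()}" and E = "\<lambda>_. topspace T" and D = "\<lambda>_. topspace T" and g = "\<lambda>_. f"])
qed (use assms in \<open>auto simp: openin_imp_sets_borel\<close>)

section \<open>Measure chains and based chains under linear combinations and push-forward\<close>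

lemma measure_chains_iff:
  "\<mu> \<in> measure_chains k X \<longleftrightarrow> finite_signed_measure (simplex_borel k X) \<mu> \<and>
     (\<exists>K. compactin (simplex_space k X) K \<and> vanishes_off (simplex_borel k X) \<mu> K)"
  by (simp add: measure_chains_def)

lemma measure_chains_zero: "(\<lambda>A. 0) \<in> measure_chains k X"
  by (auto simp: measure_chains_iff finite_signed_measure_zero vanishes_off_def intro: exI[of _ "{}"])

lemma measure_chains_add:
  assumes "\<mu> \<in> measure_chains k X" "\<nu> \<in> measure_chains k X"
  shows "(\<lambda>A. \<mu> A + \<nu> A) \<in> measure_chains k X"
proof -
  obtain K L where K: "compactin (simplex_space k X) K" "vanishes_off (simplex_borel k X) \<mu> K"
    and L: "compactin (simplex_space k X) L" "vanishes_off (simplex_borel k X) \<nu> L"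
    using assms unfolding measure_chains_iff by blast
  have "vanishes_off (simplex_borel k X) (\<lambda>A. \<mu> A + \<nu> A) (K \<union> L)"
  proof -
    have "\<mu> A = 0 \<and> \<nu> A = 0"
      if "A \<in> sets (simplex_borel k X)" "A \<subseteq> space (simplex_borel k X) - (K \<union> L)" for A
      using that K(2) L(2) unfolding vanishes_off_def by blast
    then show ?thesis by (auto simp: vanishes_off_def)
  qed
  with K(1) L(1) show ?thesis
    using assms unfolding measure_chains_iff
    by (blast intro: finite_signed_measure_add compactin_Un)
qed

lemma measure_chains_cmult:
  assumes "\<mu> \<in> measure_chains k X"
  shows "(\<lambda>A. c * \<mu> A) \<in> measure_chains k X"
proof -
  have "vanishes_off M (\<lambda>A. c * \<mu> A) K" if "vanishes_off M \<mu> K" for M K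
    using that by (auto simp: vanishes_off_def)
  then show ?thesis
    using assms unfolding measure_chains_iff by (blast intro: finite_signed_measure_cmult)
qed

lemma measure_chains_sum:
  assumes "finite I" "\<And>i. i \<in> I \<Longrightarrow> \<mu> i \<in> measure_chains k X"
  shows "(\<lambda>A. \<Sum>i\<in>I. c i * \<mu> i A) \<in> measure_chains k X"
  using assms
  by (induction I rule: finite_induct)
    (simp_all add: measure_chains_zero measure_chains_add measure_chains_cmult)

lemma measure_chains_push_forward:
  assumes \<mu>: "\<mu> \<in> measure_chains k X"
    and f: "compact_borel_map (simplex_space k X) (simplex_space m X) f"
  shows "push_forward (simplex_borel k X) (simplex_borel m X) f \<mu> \<in> measure_chains m X"
proof -
  obtain K where K: "compactin (simplex_space k X) K" "vanishes_off (simplex_borel k X) \<mu> K"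
    using \<mu> by (auto simp: measure_chains_iff)
  then obtain L where L: "compactin (simplex_space m X) L" "f ` K \<subseteq> L"
    using f by (meson compact_borel_map_def)
  have "vanishes_off (simplex_borel m X) (push_forward (simplex_borel k X) (simplex_borel m X) f \<mu>) L"
    unfolding vanishes_off_def
  proof (intro ballI impI)
    fix A assume A: "A \<in> sets (simplex_borel m X)" "A \<subseteq> space (simplex_borel m X) - L"
    have "f -` A \<inter> space (simplex_borel k X) \<in> sets (simplex_borel k X)"
      using f A(1) unfolding compact_borel_map_def by (blast intro: measurable_sets)
    moreover have "f -` A \<inter> space (simplex_borel k X) \<subseteq> space (simplex_borel k X) - K"
      using A(2) L(2) by auto
    ultimately show "push_forward (simplex_borel k X) (simplex_borel m X) f \<mu> A = 0"
      using K(2) by (simp add: vanishes_off_def push_forward_def)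
  qed
  with L(1) show ?thesis
    using \<mu> f finite_signed_measure_push_forward
    unfolding measure_chains_iff compact_borel_map_def by blast
qed

text \<open>A Borel set of simplices that are not based has a Borel preimage missing
  \<open>B\<close>, so \<open>B\<close> itself is never measured. Taking \<open>B\<close> to be the
  based simplices shows that an operator preserves based chains; \<open>B = UNIV\<close> shows that
  it makes every chain based.\<close>

lemma based_measure_chains_push_forward:
  assumes \<mu>: "\<mu> \<in> measure_chains k X"
    and van: "vanishes_off (simplex_borel k X) \<mu> B"
    and f: "compact_borel_map (simplex_space k X) (simplex_space m X) f"
    and based: "\<And>\<sigma>. singular_simplex k X \<sigma> \<Longrightarrow> \<sigma> \<in> B \<Longrightarrow> f \<sigma> \<in> based_simplices m X x0"
  shows "push_forward (simplex_borel k X) (simplex_borel m X) f \<mu> \<in> based_measure_chains m X x0"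
proof -
  have "push_forward (simplex_borel k X) (simplex_borel m X) f \<mu> A = 0"
    if A: "A \<in> sets (simplex_borel m X)" "A \<subseteq> space (simplex_borel m X) - based_simplices m X x0"
    for A
  proof -
    have "f -` A \<inter> space (simplex_borel k X) \<in> sets (simplex_borel k X)"
      using f A(1) unfolding compact_borel_map_def by (blast intro: measurable_sets)
    moreover have "f -` A \<inter> space (simplex_borel k X) \<subseteq> space (simplex_borel k X) - B"
      using A(2) based by (auto simp: topspace_simplex_space)
    ultimately show ?thesis
      using van by (simp add: vanishes_off_def push_forward_def)
  qed
  then show ?thesis
    using measure_chains_push_forward[OF \<mu> f]
    by (simp add: based_measure_chains_def vanishes_off_def)
qed

lemma based_measure_chains_zero: "(\<lambda>A. 0) \<in> based_measure_chains k X x0"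
  by (auto simp: based_measure_chains_def vanishes_off_def measure_chains_zero)

lemma based_measure_chains_add:
  "\<mu> \<in> based_measure_chains k X x0 \<Longrightarrow> \<nu> \<in> based_measure_chains k X x0 \<Longrightarrow>
     (\<lambda>A. \<mu> A + \<nu> A) \<in> based_measure_chains k X x0"
  by (auto simp: based_measure_chains_def vanishes_off_def measure_chains_add)

lemma based_measure_chains_cmult:
  "\<mu> \<in> based_measure_chains k X x0 \<Longrightarrow> (\<lambda>A. c * \<mu> A) \<in> based_measure_chains k X x0"
  by (auto simp: based_measure_chains_def vanishes_off_def measure_chains_cmult)

lemma based_measure_chains_sum:
  assumes "finite I" "\<And>i. i \<in> I \<Longrightarrow> \<mu> i \<in> based_measure_chains k X x0"
  shows "(\<lambda>A. \<Sum>i\<in>I. c i * \<mu> i A) \<in> based_measure_chains k X x0"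
  using assms
  by (induction I rule: finite_induct)
    (simp_all add: based_measure_chains_zero based_measure_chains_add based_measure_chains_cmult)

subsection \<open>The compact-open topology\<close>

lemma openin_compact_open_subbasis:
  assumes "compactin Y K" "openin X U"
  shows "openin (compact_open_topology Y X)
           {f. continuous_map Y X f \<and> f \<in> extensional (topspace Y) \<and> f ` K \<subseteq> U}"
  unfolding compact_open_topology_def using assms by (intro topology_generated_by_Basis) blast

text \<open>Tube lemma: projecting along the compact set \<open>K\<close> is a closed map, so the
  parameters \<open>z\<close> for which \<open>h z\<close> leaves \<open>U\<close> somewhere on
  \<open>K\<close> form a closed set.\<close>

lemma continuous_map_curry_compact_open:
  assumes h: "continuous_map (prod_topology Z Y) X (\<lambda>(z, y). h z y)"
  shows "continuous_map Z (compact_open_topology Y X) (\<lambda>z. restrict (h z) (topspace Y))"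
proof -
  have hz: "continuous_map Y X (restrict (h z) (topspace Y))" if "z \<in> topspace Z" for z
  proof -
    have "continuous_map Y X ((\<lambda>(z, y). h z y) \<circ> (\<lambda>y. (z, y)))"
      using that by (intro continuous_map_compose[OF _ h] continuous_map_pairedI) auto
    then show ?thesis by (rule continuous_map_eq) auto
  qed
  show ?thesis
    unfolding compact_open_topology_def
  proof (rule continuous_on_generated_topo)
    fix W assume "W \<in> {{f. continuous_map Y X f \<and> f \<in> extensional (topspace Y) \<and> f ` K \<subseteq> U} | K U.
          compactin Y K \<and> openin X U}"
    then obtain K U where K: "compactin Y K" and U: "openin X U"
      and W: "W = {f. continuous_map Y X f \<and> f \<in> extensional (topspace Y) \<and> f ` K \<subseteq> U}"
      by blast
    have KY: "K \<subseteq> topspace Y" using K by (rule compactin_subset_topspace)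
    let ?P = "prod_topology Z (subtopology Y K)"
    let ?C = "{p \<in> topspace ?P. (\<lambda>(z, y). h z y) p \<in> topspace X - U}"
    have "continuous_map ?P X (\<lambda>(z, y). h z y)"
      using h by (simp add: prod_topology_subtopology(2) continuous_map_from_subtopology)
    then have "closedin ?P ?C"
      using U by (intro closedin_continuous_map_preimage) auto
    moreover have "closed_map ?P Z fst"
      using K by (intro closed_map_fst) (simp add: compact_space_subtopology)
    ultimately have clo: "closedin Z (fst ` ?C)"
      unfolding closed_map_def by blast
    have eq: "(\<lambda>z. restrict (h z) (topspace Y)) -` W \<inter> topspace Z = topspace Z - fst ` ?C"
    proof (rule Set.set_eqI)
      fix z
      show "z \<in> (\<lambda>z. restrict (h z) (topspace Y)) -` W \<inter> topspace Z \<longleftrightarrow> z \<in> topspace Z - fst ` ?C"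
      proof (cases "z \<in> topspace Z")
        case True
        have X: "h z y \<in> topspace X" if "y \<in> K" for y
          using hz[OF True] KY that by (auto simp: continuous_map_def Pi_iff)
        have "z \<in> fst ` ?C \<longleftrightarrow> (\<exists>y\<in>K. h z y \<notin> U)"
        proof
          assume "\<exists>y\<in>K. h z y \<notin> U"
          then obtain y where "y \<in> K" "h z y \<notin> U" by blast
          then have "(z, y) \<in> ?C" using True KY X by auto
          then show "z \<in> fst ` ?C" by force
        qed auto
        moreover have "restrict (h z) (topspace Y) \<in> W \<longleftrightarrow> (\<forall>y\<in>K. h z y \<in> U)"
        proof -
          have "restrict (h z) (topspace Y) y = h z y" if "y \<in> K" for y
            using that KY by auto
          then show ?thesis
            using hz[OF True] unfolding W by (simp add: image_subset_iff)
        qed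
        ultimately show ?thesis using True by blast
      qed blast
    qed
    show "openin Z ((\<lambda>z. restrict (h z) (topspace Y)) -` W \<inter> topspace Z)"
      unfolding eq using clo by (rule openin_diff[OF openin_topspace])
  next
    show "(\<lambda>z. restrict (h z) (topspace Y)) ` topspace Z \<subseteq> \<Union> {{f. continuous_map Y X f \<and>
            f \<in> extensional (topspace Y) \<and> f ` K \<subseteq> U} | K U. compactin Y K \<and> openin X U}"
    proof (rule image_subsetI)
      fix z assume "z \<in> topspace Z"
      then show "restrict (h z) (topspace Y) \<in> \<Union> {{f. continuous_map Y X f \<and>
            f \<in> extensional (topspace Y) \<and> f ` K \<subseteq> U} | K U. compactin Y K \<and> openin X U}"
        using hz[of z]
        by (intro UnionI[of "{f. continuous_map Y X f \<and> f \<in> extensional (topspace Y) \<and> f ` {} \<subseteq> topspace X}"]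
            CollectI exI[of _ "{}"] exI[of _ "topspace X"] conjI refl) simp_all
    qed
  qed
qed

text \<open>A compact neighbourhood \<open>K\<close> of \<open>y\<close> inside the preimage of
  \<open>U\<close> under \<open>f\<close> yields a subbasic neighbourhood of \<open>f\<close>, all
  of whose members map \<open>K\<close> into \<open>U\<close>.\<close>

lemma continuous_map_eval_compact_open:
  assumes "neighbourhood_base_of (compactin Y) Y"
  shows "continuous_map (prod_topology (compact_open_topology Y X) Y) X (\<lambda>(f, y). f y)"
  unfolding continuous_map_openin_preimage_eq
proof (intro conjI allI impI)
  show "(\<lambda>(f, y). f y) \<in> topspace (prod_topology (compact_open_topology Y X) Y) \<rightarrow> topspace X"
    by (auto simp: topspace_compact_open_topology continuous_map_def)
  fix U assume U: "openin X U"
  let ?S = "topspace (prod_topology (compact_open_topology Y X) Y) \<inter> (\<lambda>(f, y). f y) -` U"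
  show "openin (prod_topology (compact_open_topology Y X) Y) ?S"
    unfolding openin_prod_topology_alt
  proof (intro allI impI)
    fix f y assume "(f, y) \<in> ?S"
    then have f: "continuous_map Y X f" "f \<in> extensional (topspace Y)"
      and y: "y \<in> topspace Y" "f y \<in> U"
      by (auto simp: topspace_compact_open_topology)
    have "openin Y {z \<in> topspace Y. f z \<in> U}"
      using f(1) U by (rule openin_continuous_map_preimage)
    then obtain V K where V: "openin Y V" "compactin Y K" "y \<in> V" "V \<subseteq> K"
      "K \<subseteq> {z \<in> topspace Y. f z \<in> U}"
      using assms y unfolding neighbourhood_base_of by (smt (verit, best) mem_Collect_eq)
    let ?W = "{g. continuous_map Y X g \<and> g \<in> extensional (topspace Y) \<and> g ` K \<subseteq> U}"
    have "openin (compact_open_topology Y X) ?W"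
      using V(2) U by (rule openin_compact_open_subbasis)
    moreover have "f \<in> ?W" using f V(5) by auto
    moreover have "?W \<times> V \<subseteq> ?S"
    proof -
      have "g z \<in> U" if "g \<in> ?W" "z \<in> V" for g z
        using that V(4) by blast
      then show ?thesis
        using openin_subset[OF V(1)] by (auto simp: topspace_compact_open_topology)
    qed
    ultimately show "\<exists>W V. openin (compact_open_topology Y X) W \<and> openin Y V \<and> f \<in> W \<and> y \<in> V \<and> W \<times> V \<subseteq> ?S"
      using V(1,3) by blast
  qed
qed

section \<open>Evaluation of singular simplices, and continuous maps into spaces of
  simplices\<close>

abbreviation simplex_top :: "nat \<Rightarrow> (nat \<Rightarrow> real) topology" where
  "simplex_top k \<equiv> subtopology (powertop_real UNIV) (standard_simplex k)"

lemma neighbourhood_base_compactin_simplex_top: "neighbourhood_base_of (compactin (simplex_top k)) (simplex_top k)"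
proof (rule locally_compact_imp_neighbourhood_base)
  have comp: "compact_space (simplex_top k)"
    by (simp add: compactin_standard_simplex compact_space_subtopology)
  have Haus: "Hausdorff_space (simplex_top k)"
    by (intro Hausdorff_space_subtopology) (simp add: Hausdorff_space_product_topology)
  show "locally_compact_space (simplex_top k)"
    using comp by (rule compact_imp_locally_compact_space)
  show "regular_space (simplex_top k)"
    using comp Haus by (rule compact_Hausdorff_imp_regular_space)
qed

lemma continuous_map_eval_simplex:
  assumes "continuous_map T (simplex_space k X) f" "continuous_map T (simplex_top k) t"
  shows "continuous_map T X (\<lambda>x. f x (t x))"
proof -
  have "continuous_map T (prod_topology (simplex_space k X) (simplex_top k)) (\<lambda>x. (f x, t x))"
    using assms by (intro continuous_map_pairedI)
  then have "continuous_map T X ((\<lambda>(f, y). f y) \<circ> (\<lambda>x. (f x, t x)))"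
    unfolding simplex_space_def
    by (rule continuous_map_compose)
      (intro continuous_map_eval_compact_open neighbourhood_base_compactin_simplex_top)
  then show ?thesis by (simp add: o_def)
qed

lemma continuous_map_into_simplex_space:
  assumes "continuous_map (prod_topology Z (simplex_top m)) X (\<lambda>(z, a). h z a)"
  shows "continuous_map Z (simplex_space m X) (\<lambda>z. restrict (h z) (standard_simplex m))"
  using continuous_map_curry_compact_open[OF assms] unfolding simplex_space_def by simp

subsection \<open>Alternating double sums\<close>

text \<open>The combinatorics of a squared boundary: \<open>(i, j)\<close> with
  \<open>i \<le> j\<close> is paired with \<open>(Suc j, i)\<close>, which carries the same value
  and the opposite sign.\<close>

lemma alternating_face_face_sum:
  fixes V :: "nat \<Rightarrow> nat \<Rightarrow> real"
  assumes V: "\<And>i j. i \<le> j \<Longrightarrow> j \<le> k \<Longrightarrow> V i j = V (Suc j) i"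
  shows "(\<Sum>j\<le>k. \<Sum>i\<le>Suc k. (-1) ^ (i + j) * V i j) = 0"
proof -
  let ?f = "\<lambda>(i, j). (-1) ^ (i + j) * V i j"
  let ?A = "{..Suc k} \<times> {..k}"
  let ?L = "{(i, j). i \<le> j \<and> j \<le> k}" and ?R = "{(i, j). j < i \<and> i \<le> Suc k}"
  have fin: "finite ?L" "finite ?R"
    by (rule finite_subset[of _ "{..Suc k} \<times> {..Suc k}"], clarsimp, simp)+
  have "(\<Sum>j\<le>k. \<Sum>i\<le>Suc k. (-1) ^ (i + j) * V i j) = sum ?f ?A"
    by (subst sum.swap) (simp only: sum.cartesian_product)
  also have "?A = ?L \<union> ?R" by auto
  also have "sum ?f (?L \<union> ?R) = sum ?f ?L + sum ?f ?R"
  proof (rule sum.union_disjoint[OF fin], rule equals0I)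
    show False if "p \<in> ?L \<inter> ?R" for p using that by (cases p) (simp; linarith)
  qed
  also have "sum ?f ?R = (\<Sum>(i, j)\<in>?L. - ((-1) ^ (i + j) * V i j))"
  proof (rule sum.reindex_bij_witness[of _ "\<lambda>(i, j). (Suc j, i)" "\<lambda>(i, j). (j, i - 1)"])
    fix p assume "p \<in> ?R"
    then obtain i j where p: "p = (Suc i, j)" "j \<le> i" "i \<le> k"
      by (cases p; cases "fst p") auto
    then show "(case case p of (i, j) \<Rightarrow> (j, i - 1) of (i, j) \<Rightarrow> - ((-1) ^ (i + j) * V i j)) = ?f p"
      using V[of j i] by (simp add: add.commute)
  qed auto
  also have "\<dots> = - sum ?f ?L"
    by (simp add: sum_negf case_prod_unfold)
  finally show ?thesis by simp
qed

text \<open>Read \<open>T i j\<close> as face \<open>i\<close> of prism simplex \<open>j\<close>,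
  and \<open>U i j\<close> as prism simplex \<open>j\<close> over face \<open>i\<close>. Away from
  the diagonals \<open>i = j\<close> and \<open>i = Suc j\<close> the terms of \<open>T\<close>
  cancel against \<open>U\<close> after an index shift. The two diagonals have opposite signs and
  cancel each other except at the top and the bottom of the prism.\<close>

lemma alternating_prism_sum:
  fixes T U :: "nat \<Rightarrow> nat \<Rightarrow> real"
  assumes lt: "\<And>i j. i \<le> j \<Longrightarrow> j \<le> k \<Longrightarrow> T i (Suc j) = U i j"
    and gt: "\<And>i j. j < i \<Longrightarrow> i \<le> Suc k \<Longrightarrow> T (Suc i) j = U i j"
    and eq: "\<And>j. j \<le> k \<Longrightarrow> T (Suc j) j = T (Suc j) (Suc j)"
  shows "(\<Sum>i\<le>Suc (Suc k). \<Sum>j\<le>Suc k. (-1) ^ (i + j) * T i j)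
           + (\<Sum>i\<le>Suc k. \<Sum>j\<le>k. (-1) ^ (i + j) * U i j)
         = T 0 0 - T (Suc (Suc k)) (Suc k)"
proof -
  let ?f = "\<lambda>T (i, j). (-1) ^ (i + j) * (T i j :: real)"
  let ?L = "{(i, j). i < j \<and> j \<le> Suc k}" and ?G = "{(i, j). Suc j < i \<and> i \<le> Suc (Suc k)}"
  let ?D = "(\<lambda>j. (j, j)) ` {..Suc k}" and ?D' = "(\<lambda>j. (Suc j, j)) ` {..Suc k}"
  let ?L' = "{(i, j). i \<le> j \<and> j \<le> k}" and ?G' = "{(i, j). j < i \<and> i \<le> Suc k}"
  have fin: "finite ?L" "finite ?G" "finite ?L'" "finite ?G'"
    by (rule finite_subset[of _ "{..Suc (Suc k)} \<times> {..Suc (Suc k)}"], clarsimp, simp)+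
  have "(\<Sum>i\<le>Suc (Suc k). \<Sum>j\<le>Suc k. (-1) ^ (i + j) * T i j) = sum (?f T) ({..Suc (Suc k)} \<times> {..Suc k})"
    by (simp only: sum.cartesian_product)
  also have "{..Suc (Suc k)} \<times> {..Suc k} = (?L \<union> ?G) \<union> (?D \<union> ?D')"
  proof (rule Set.set_eqI)
    fix p :: "nat \<times> nat"
    obtain i j where p: "p = (i, j)" by (cases p)
    have "i < j \<or> Suc j < i \<or> i = j \<or> i = Suc j" by linarith
    then show "p \<in> {..Suc (Suc k)} \<times> {..Suc k} \<longleftrightarrow> p \<in> (?L \<union> ?G) \<union> (?D \<union> ?D')"
      unfolding p by (auto simp: image_iff)
  qed
  also have "sum (?f T) \<dots> = (sum (?f T) ?L + sum (?f T) ?G) + (sum (?f T) ?D + sum (?f T) ?D')"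
  proof -
    have "(?L \<union> ?G) \<inter> (?D \<union> ?D') = {}"
    proof (rule equals0I)
      show False if "p \<in> (?L \<union> ?G) \<inter> (?D \<union> ?D')" for p
        using that by (cases p) (elim IntE UnE imageE; simp)
    qed
    then have "sum (?f T) ((?L \<union> ?G) \<union> (?D \<union> ?D')) = sum (?f T) (?L \<union> ?G) + sum (?f T) (?D \<union> ?D')"
      using fin by (intro sum.union_disjoint finite_UnI finite_imageI finite_atMost)
    moreover have "?L \<inter> ?G = {}"
    proof (rule equals0I)
      show False if "p \<in> ?L \<inter> ?G" for p using that by (cases p) (simp; linarith)
    qed
    then have "sum (?f T) (?L \<union> ?G) = sum (?f T) ?L + sum (?f T) ?G"
      using fin by (intro sum.union_disjoint)
    moreover have "?D \<inter> ?D' = {}"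
    proof (rule equals0I)
      show False if "p \<in> ?D \<inter> ?D'" for p using that by (elim IntE imageE) simp
    qed
    then have "sum (?f T) (?D \<union> ?D') = sum (?f T) ?D + sum (?f T) ?D'"
      by (intro sum.union_disjoint finite_imageI finite_atMost)
    ultimately show ?thesis by argo
  qed
  finally have A: "(\<Sum>i\<le>Suc (Suc k). \<Sum>j\<le>Suc k. (-1) ^ (i + j) * T i j) =
      (sum (?f T) ?L + sum (?f T) ?G) + (sum (?f T) ?D + sum (?f T) ?D')" .
  have "(\<Sum>i\<le>Suc k. \<Sum>j\<le>k. (-1) ^ (i + j) * U i j) = sum (?f U) ({..Suc k} \<times> {..k})"
    by (simp only: sum.cartesian_product)
  also have "{..Suc k} \<times> {..k} = ?L' \<union> ?G'" by auto
  also have "sum (?f U) \<dots> = sum (?f U) ?L' + sum (?f U) ?G'"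
  proof (rule sum.union_disjoint[OF fin(3,4)], rule equals0I)
    show False if "p \<in> ?L' \<inter> ?G'" for p using that by (cases p) (simp; linarith)
  qed
  finally have B: "(\<Sum>i\<le>Suc k. \<Sum>j\<le>k. (-1) ^ (i + j) * U i j) = sum (?f U) ?L' + sum (?f U) ?G'" .
  have "sum (?f T) ?L = (\<Sum>p\<in>?L'. - ?f U p)"
  proof (rule sum.reindex_bij_witness[of _ "\<lambda>(i, j). (i, Suc j)" "\<lambda>(i, j). (i, j - 1)"])
    fix p assume "p \<in> ?L"
    then obtain i j where "p = (i, Suc j)" "i \<le> j" "j \<le> k"
      by (cases p; cases "snd p") auto
    then show "- ?f U (case p of (i, j) \<Rightarrow> (i, j - 1)) = ?f T p"
      using lt[of i j] by simp
  qed auto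
  then have L: "sum (?f T) ?L = - sum (?f U) ?L'" by (simp add: sum_negf)
  have "sum (?f T) ?G = (\<Sum>p\<in>?G'. - ?f U p)"
  proof (rule sum.reindex_bij_witness[of _ "\<lambda>(i, j). (Suc i, j)" "\<lambda>(i, j). (i - 1, j)"])
    fix p assume "p \<in> ?G"
    then obtain i j where "p = (Suc i, j)" "j < i" "i \<le> Suc k"
      by (cases p; cases "fst p") auto
    then show "- ?f U (case p of (i, j) \<Rightarrow> (i - 1, j)) = ?f T p"
      using gt[of j i] by simp
  qed auto
  then have G: "sum (?f T) ?G = - sum (?f U) ?G'" by (simp add: sum_negf)
  have "sum (?f T) ?D = (\<Sum>j\<le>Suc k. T j j)"
    by (subst sum.reindex) (auto simp: inj_on_def mult_2[symmetric] power_mult)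
  also have "\<dots> = T 0 0 + (\<Sum>j\<le>k. T (Suc j) (Suc j))"
    by (rule sum.atMost_Suc_shift)
  also have "(\<Sum>j\<le>k. T (Suc j) (Suc j)) = (\<Sum>j\<le>k. T (Suc j) j)"
    by (rule sum.cong) (simp_all add: eq)
  finally have D: "sum (?f T) ?D = T 0 0 + (\<Sum>j\<le>k. T (Suc j) j)" .
  have "sum (?f T) ?D' = - (\<Sum>j\<le>Suc k. T (Suc j) j)"
    by (subst sum.reindex) (auto simp: inj_on_def mult_2[symmetric] power_mult sum_negf)
  then show ?thesis
    unfolding A B L G D by simp
qed

subsection \<open>Squeezing a simplex towards its vertices\<close>

text \<open>As \<open>s\<close> grows, \<open>squeeze k s\<close> sends an ever larger neighbourhood of each vertex to that vertex. The
  constants are chosen such that \<open>excess k s t \<noteq> 0\<close> forces \<open>squeeze k s t\<close> to be a vertex. The sum of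
  squares serves as cutoff scale because it is invariant under face maps.\<close>

definition simplex_sq :: "nat \<Rightarrow> (nat \<Rightarrow> real) \<Rightarrow> real" where
  "simplex_sq k t = (\<Sum>i\<le>k. (t i)\<^sup>2)"

definition cutoff :: "nat \<Rightarrow> real \<Rightarrow> (nat \<Rightarrow> real) \<Rightarrow> nat \<Rightarrow> real" where
  "cutoff k s t i = max 0 (t i - s / 2 * simplex_sq k t)"

definition squeeze :: "nat \<Rightarrow> real \<Rightarrow> (nat \<Rightarrow> real) \<Rightarrow> nat \<Rightarrow> real" where
  "squeeze k s t i = cutoff k s t i / (\<Sum>j\<le>k. cutoff k s t j)"

definition excess :: "nat \<Rightarrow> real \<Rightarrow> (nat \<Rightarrow> real) \<Rightarrow> real" where
  "excess k s t = max 0 (s - 3 * (1 - simplex_sq k t))"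

abbreviation simplex_vertex :: "nat \<Rightarrow> nat \<Rightarrow> real" where
  "simplex_vertex l \<equiv> (\<lambda>j. if j = l then 1 else 0)"

lemma standard_simplexD:
  assumes "t \<in> standard_simplex k"
  shows "0 \<le> t i" "t i \<le> 1" "i > k \<Longrightarrow> t i = 0" "(\<Sum>i\<le>k. t i) = 1"
  using assms by (auto simp: standard_simplex_def)

lemma standard_simplex_pair_le:
  assumes t: "t \<in> standard_simplex k" and "i \<noteq> l"
  shows "t i + t l \<le> 1"
proof (cases "i \<le> k \<and> l \<le> k")
  case True
  have "t i + t l = sum t {i, l}" using \<open>i \<noteq> l\<close> by simp
  also have "\<dots> \<le> sum t {..k}"
    using True by (intro sum_mono2) (auto simp: standard_simplexD[OF t])
  finally show ?thesis by (simp add: standard_simplexD[OF t])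
next
  case False
  then show ?thesis
    using standard_simplexD(2,3)[OF t] by (metis add.left_neutral add.right_neutral not_le_imp_less)
qed

text \<open>The largest coordinate works: the sum of squares is at most it times the sum of all
  coordinates, which is 1.\<close>

lemma simplex_sq_le_coordinate:
  assumes t: "t \<in> standard_simplex k"
  obtains l where "l \<le> k" "simplex_sq k t \<le> t l"
proof -
  obtain l where l: "l \<le> k" "\<And>i. i \<le> k \<Longrightarrow> t i \<le> t l"
  proof -
    have "Max (t ` {..k}) \<in> t ` {..k}" by (rule Max_in) auto
    then obtain l where "l \<le> k" "t l = Max (t ` {..k})" by force
    then show ?thesis using that by simp
  qed
  have "simplex_sq k t \<le> (\<Sum>i\<le>k. t l * t i)"
    unfolding simplex_sq_def power2_eq_square
    using l by (intro sum_mono mult_right_mono) (auto simp: standard_simplexD[OF t])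
  also have "\<dots> = t l" by (simp add: sum_distrib_left[symmetric] standard_simplexD[OF t])
  finally show ?thesis using l(1) that by blast
qed

lemma simplex_sq_bounds:
  assumes t: "t \<in> standard_simplex k"
  shows "0 < simplex_sq k t" "simplex_sq k t \<le> 1"
proof -
  show "simplex_sq k t \<le> 1"
    using simplex_sq_le_coordinate[OF t] standard_simplexD(2)[OF t] by (meson order_trans)
  have "simplex_sq k t \<noteq> 0"
  proof
    assume "simplex_sq k t = 0"
    then have "\<forall>i\<in>{..k}. (t i)\<^sup>2 = 0"
      unfolding simplex_sq_def by (subst (asm) sum_nonneg_eq_0_iff) auto
    then have "(\<Sum>i\<le>k. t i) = 0" by simp
    then show False by (simp add: standard_simplexD[OF t])
  qed
  moreover have "0 \<le> simplex_sq k t" unfolding simplex_sq_def by (rule sum_nonneg) simp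
  ultimately show "0 < simplex_sq k t" by simp
qed

text \<open>The factor 1/2 in \<open>cutoff\<close> keeps the threshold strictly below the sum of
  squares, even for \<open>s = 1\<close>, so the largest coordinate survives. This makes the
  division in \<open>squeeze\<close> legitimate.\<close>

lemma cutoff_sum_pos:
  assumes t: "t \<in> standard_simplex k" and s: "0 \<le> s" "s \<le> 1"
  shows "0 < (\<Sum>j\<le>k. cutoff k s t j)"
proof -
  obtain l where l: "l \<le> k" "simplex_sq k t \<le> t l"
    using simplex_sq_le_coordinate[OF t] .
  have "s / 2 * simplex_sq k t < 1 * simplex_sq k t"
    using s simplex_sq_bounds(1)[OF t] by (intro mult_strict_right_mono) auto
  then have "0 < cutoff k s t l" using l(2) by (simp add: cutoff_def)
  then show ?thesis
    using l(1) by (intro sum_pos2[of _ l]) (auto simp: cutoff_def)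
qed

lemma squeeze_in_standard_simplex:
  assumes t: "t \<in> standard_simplex k" and s: "0 \<le> s" "s \<le> 1"
  shows "squeeze k s t \<in> standard_simplex k"
proof -
  note pos = cutoff_sum_pos[OF assms]
  have nonneg: "0 \<le> cutoff k s t i" for i by (simp add: cutoff_def)
  have out: "cutoff k s t i = 0" if "i > k" for i
    using that s simplex_sq_bounds(1)[OF t] by (simp add: cutoff_def standard_simplexD[OF t])
  have "cutoff k s t i \<le> (\<Sum>j\<le>k. cutoff k s t j)" for i
    using out[of i] pos nonneg by (cases "i \<le> k") (auto intro: member_le_sum)
  then show ?thesis
    using pos nonneg out
    by (simp add: standard_simplex_def squeeze_def sum_divide_distrib[symmetric] divide_le_eq_1)
qed

text \<open>Here the constants meet. Write \<open>q\<close> for the sum of squares. The factor 3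
  gives \<open>q \<ge> 2/3\<close>, hence a coordinate of at least \<open>q\<close>; it is the only
  one reaching 2/3, since two would add up to more than 1. Every other coordinate is at most
  \<open>1 - q \<le> s/3\<close>, which is \<open>s/2\<close> times 2/3 and so at most the
  threshold: it is cut to 0.\<close>

lemma squeeze_corner:
  assumes t: "t \<in> standard_simplex k" and s: "0 \<le> s" "s \<le> 1"
    and corner: "3 * (1 - simplex_sq k t) \<le> s"
  shows "\<exists>l\<le>k. 2/3 \<le> t l" and "2/3 \<le> t l \<Longrightarrow> squeeze k s t = simplex_vertex l"
proof -
  obtain l' where l': "l' \<le> k" "simplex_sq k t \<le> t l'"
    using simplex_sq_le_coordinate[OF t] .
  have sq: "2/3 \<le> simplex_sq k t" using corner s(2) by argo
  have "2/3 \<le> t l'" using sq l'(2) by (rule order_trans)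
  then show "\<exists>l\<le>k. 2/3 \<le> t l" using l'(1) by blast
  assume l: "2/3 \<le> t l"
  then have "l = l'"
    using standard_simplex_pair_le[OF t, of l l'] \<open>2/3 \<le> t l'\<close> by fastforce
  have "cutoff k s t i = 0" if "i \<noteq> l" for i
  proof -
    have "t i \<le> s / 3"
    proof -
      have "t i + t l' \<le> 1"
        using standard_simplex_pair_le[OF t that] \<open>l = l'\<close> by simp
      then show ?thesis using l'(2) corner by argo
    qed
    also have "\<dots> = s / 2 * (2/3)" by simp
    also have "\<dots> \<le> s / 2 * simplex_sq k t"
      using sq s(1) by (intro mult_left_mono) auto
    finally show ?thesis by (simp add: cutoff_def)
  qed
  moreover from this have "(\<Sum>j\<le>k. cutoff k s t j) = cutoff k s t l"
    using l'(1) \<open>l = l'\<close> by (subst sum.remove[of _ l]) auto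
  ultimately show "squeeze k s t = simplex_vertex l"
    using cutoff_sum_pos[OF t s] by (auto simp: squeeze_def)
qed

lemma simplex_sq_vertex: "l \<le> k \<Longrightarrow> simplex_sq k (simplex_vertex l) = 1"
  by (simp add: simplex_sq_def if_distrib[of "\<lambda>x. x\<^sup>2"] cong: if_cong)

lemma squeeze_vertex:
  assumes "l \<le> k" "0 \<le> s" "s \<le> 1"
  shows "squeeze k s (simplex_vertex l) = simplex_vertex l"
  using assms by (intro squeeze_corner(2)) (simp_all add: simplex_sq_vertex)

lemma excess_vertex: "l \<le> k \<Longrightarrow> 0 \<le> s \<Longrightarrow> excess k s (simplex_vertex l) = s"
  by (simp add: excess_def simplex_sq_vertex)

lemma squeeze_0:
  assumes t: "t \<in> standard_simplex k"
  shows "squeeze k 0 t = t"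
proof -
  have "cutoff k 0 t = t" by (rule ext) (simp add: cutoff_def standard_simplexD[OF t])
  then show ?thesis by (auto simp: squeeze_def standard_simplexD[OF t])
qed

lemma excess_0: "t \<in> standard_simplex k \<Longrightarrow> excess k 0 t = 0"
  using simplex_sq_bounds(2) by (simp add: excess_def)

lemma excess_bounds:
  assumes "t \<in> standard_simplex k" "0 \<le> s" "s \<le> 1"
  shows "0 \<le> excess k s t" "excess k s t \<le> 1"
  using simplex_sq_bounds(2)[OF assms(1)] assms(2,3) by (auto simp: excess_def)

lemma excess_nonzero_imp:
  assumes "t \<in> standard_simplex k" "0 \<le> s" "s \<le> 1" "excess k s t \<noteq> 0"
  shows "3 * (1 - simplex_sq k t) \<le> s"
  using assms(4) by (auto simp: excess_def max_def split: if_splits)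

section \<open>Compatibility of squeezing with face maps\<close>

lemma sum_simplical_face:
  fixes f :: "'a::comm_monoid_add \<Rightarrow> 'b::comm_monoid_add"
  assumes "i \<le> Suc k" "f 0 = 0"
  shows "(\<Sum>j\<le>Suc k. f (simplical_face i t j)) = (\<Sum>j\<le>k. f (t j))"
proof -
  have "(\<Sum>j\<le>Suc k. f (simplical_face i t j)) = (\<Sum>j\<in>{..Suc k} - {i}. f (simplical_face i t j))"
    using assms by (subst sum.remove[of _ i]) (auto simp: simplical_face_def)
  also have "\<dots> = (\<Sum>j\<le>k. f (t j))"
    using assms(1)
    by (intro sum.reindex_bij_witness[of _ "\<lambda>j. if j < i then j else Suc j" "\<lambda>j. if j < i then j else j - 1"])
      (auto simp: simplical_face_def)
  finally show ?thesis .
qed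

lemma simplex_sq_face: "i \<le> Suc k \<Longrightarrow> simplex_sq (Suc k) (simplical_face i t) = simplex_sq k t"
  unfolding simplex_sq_def by (rule sum_simplical_face) auto

lemma excess_face: "i \<le> Suc k \<Longrightarrow> excess (Suc k) s (simplical_face i t) = excess k s t"
  by (simp add: excess_def simplex_sq_face)

text \<open>One function \<open>f\<close> acts on all coordinates, and its threshold does not notice
  an inserted zero. As \<open>f 0 = 0\<close>, the inserted coordinate stays zero and the
  normalising sum is unchanged.\<close>

lemma squeeze_face:
  assumes i: "i \<le> Suc k" and t: "t \<in> standard_simplex k" and s: "0 \<le> s"
  shows "squeeze (Suc k) s (simplical_face i t) = simplical_face i (squeeze k s t)"
proof -
  define f where "f x = max 0 (x - s / 2 * simplex_sq k t)" for x
  have f0: "f 0 = 0"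
    using s simplex_sq_bounds(1)[OF t] by (simp add: f_def)
  have "cutoff (Suc k) s (simplical_face i t) j = f (simplical_face i t j)" for j
    using i by (simp add: cutoff_def f_def simplex_sq_face)
  moreover have "cutoff k s t j = f (t j)" for j
    by (simp add: cutoff_def f_def)
  ultimately show ?thesis
    using sum_simplical_face[of i k f t] i f0
    by (auto simp: squeeze_def simplical_face_def fun_eq_iff)
qed

section \<open>Joint continuity in time and point\<close>

lemma continuous_map_simplex_coordinate:
  "continuous_map T (simplex_top k) t \<Longrightarrow> continuous_map T euclideanreal (\<lambda>x. t x i)"
  by (auto simp: continuous_map_in_subtopology continuous_map_componentwise_UNIV)

lemma continuous_map_simplex_sq:
  "continuous_map T (simplex_top k) t \<Longrightarrow> continuous_map T euclideanreal (\<lambda>x. simplex_sq k (t x))"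
  unfolding simplex_sq_def
  by (intro continuous_map_sum continuous_map_real_pow continuous_map_simplex_coordinate) auto

lemma continuous_map_excess:
  assumes "continuous_map T (simplex_top k) t" "continuous_map T euclideanreal s"
  shows "continuous_map T euclideanreal (\<lambda>x. excess k (s x) (t x))"
  unfolding excess_def
  by (intro continuous_map_real_max continuous_map_diff continuous_map_real_mult continuous_map_simplex_sq assms)
    auto

lemma continuous_map_squeeze:
  assumes t: "continuous_map T (simplex_top k) t" and s: "continuous_map T euclideanreal s"
    and s01: "\<And>x. x \<in> topspace T \<Longrightarrow> 0 \<le> s x \<and> s x \<le> 1"
  shows "continuous_map T (simplex_top k) (\<lambda>x. squeeze k (s x) (t x))"
proof -
  have tx: "t x \<in> standard_simplex k" if "x \<in> topspace T" for x
    using t that by (auto simp: continuous_map_in_subtopology)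
  have cut: "continuous_map T euclideanreal (\<lambda>x. cutoff k (s x) (t x) i)" for i
    unfolding cutoff_def
    by (intro continuous_map_real_max continuous_map_diff continuous_map_real_mult
        continuous_map_real_divide continuous_map_simplex_sq[OF t] continuous_map_simplex_coordinate[OF t] s) auto
  have "continuous_map T euclideanreal (\<lambda>x. squeeze k (s x) (t x) i)" for i
    unfolding squeeze_def
    using cutoff_sum_pos tx s01
    by (intro continuous_map_real_divide continuous_map_sum cut) fastforce+
  then show ?thesis
    using squeeze_in_standard_simplex tx s01
    by (auto simp: continuous_map_in_subtopology continuous_map_componentwise_UNIV)
qed

subsection \<open>Contracting the vertices of a simplex\<close>

text \<open>\<open>idx\<close> is the discontinuous choice, while each \<open>H i\<close> is
  continuous on its closed set \<open>C i\<close>. \<open>H_0\<close> is demanded for all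
  \<open>i\<close> and \<open>x\<close> because at time 0 the index in use may be arbitrary, even
  outside \<open>I\<close>.\<close>

locale local_contractions =
  fixes X :: "'a topology" and I :: "'i set" and C :: "'i \<Rightarrow> 'a set"
    and idx :: "'a \<Rightarrow> 'i" and H :: "'i \<Rightarrow> real \<Rightarrow> 'a \<Rightarrow> 'a" and x0 :: 'a
  assumes finite_I: "finite I"
    and closedin_C: "i \<in> I \<Longrightarrow> closedin X (C i)"
    and idx: "x \<in> topspace X \<Longrightarrow> idx x \<in> I" "x \<in> topspace X \<Longrightarrow> x \<in> C (idx x)"
    and idx_borel: "i \<in> I \<Longrightarrow> {x \<in> topspace X. idx x = i} \<in> sets (borel_space_of X)"
    and H_cont: "i \<in> I \<Longrightarrow>
      continuous_map (prod_topology (top_of_set {0..1}) (subtopology X (C i))) X (\<lambda>(s, x). H i s x)"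
    and H_0: "H i 0 x = x"
    and H_1: "i \<in> I \<Longrightarrow> x \<in> C i \<Longrightarrow> H i 1 x = x0"
begin

text \<open>A point of the squeezed simplex moves along the contraction selected by its index for the time
  \<open>excess\<close>. Since \<open>excess\<close> vanishes unless the point is a vertex of \<open>\<sigma>\<close>, only the indices of the vertices
  matter, so \<open>slide\<close> is continuous on each of the finitely many Borel pieces on which they are constant.\<close>

definition slide ::
    "nat \<Rightarrow> nat \<Rightarrow> ((nat \<Rightarrow> real) \<Rightarrow> nat \<Rightarrow> real) \<Rightarrow> ((nat \<Rightarrow> real) \<Rightarrow> real) \<Rightarrow>
      ((nat \<Rightarrow> real) \<Rightarrow> 'a) \<Rightarrow> (nat \<Rightarrow> real) \<Rightarrow> 'a" where
  "slide k m \<tau> s \<sigma> =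
     (\<lambda>a\<in>standard_simplex m. H (idx (\<sigma> (squeeze k (s a) (\<tau> a)))) (excess k (s a) (\<tau> a))
        (\<sigma> (squeeze k (s a) (\<tau> a))))"

text \<open>Once the indices of the vertices are prescribed by \<open>c\<close>, the formula
  \<open>g c\<close> no longer involves \<open>idx\<close> and is jointly continuous in
  \<open>\<sigma>\<close> and \<open>a\<close> on the closed set \<open>D c\<close>. It agrees with
  \<open>slide\<close> on the Borel set \<open>E c\<close>, and there are finitely many
  \<open>c\<close>.\<close>

lemma compact_borel_map_slide:
  assumes \<tau>: "continuous_map (simplex_top m) (simplex_top k) \<tau>"
    and s: "continuous_map (simplex_top m) (top_of_set {0..1}) s"
  shows "compact_borel_map (simplex_space k X) (simplex_space m X) (slide k m \<tau> s)"
proof -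
  define J where "J = {..k} \<rightarrow>\<^sub>E I"
  define E where "E c = {\<sigma> \<in> topspace (simplex_space k X). \<forall>l\<in>{..k}. idx (\<sigma> (simplex_vertex l)) = c l}" for c
  define D where "D c = {\<sigma> \<in> topspace (simplex_space k X). \<forall>l\<in>{..k}. \<sigma> (simplex_vertex l) \<in> C (c l)}" for c
  \<comment> \<open>A vertex is named from the point \<open>t\<close> alone, independently of
    \<open>\<sigma>\<close>. If no coordinate reaches 2/3 the value is arbitrary; then the excess is
    0 and \<open>H_0\<close> makes the index irrelevant.\<close>
  define corner where "corner t = (SOME l. l \<le> k \<and> 2/3 \<le> (t l :: real))" for t
  define g where "g c \<sigma> a = H (c (corner (\<tau> a))) (excess k (s a) (\<tau> a)) (\<sigma> (squeeze k (s a) (\<tau> a)))" for c \<sigma> a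
  have \<tau>a: "\<tau> a \<in> standard_simplex k" if "a \<in> standard_simplex m" for a
    using \<tau> that by (auto simp: continuous_map_in_subtopology)
  have s01: "0 \<le> s a \<and> s a \<le> 1" if "a \<in> standard_simplex m" for a
    using s that by (auto simp: continuous_map_in_subtopology)
  have vertex: "continuous_map (simplex_space k X) X (\<lambda>\<sigma>. \<sigma> (simplex_vertex l))" if "l \<le> k" for l
    using that continuous_map_eval_simplex[of "simplex_space k X" k X "\<lambda>\<sigma>. \<sigma>" "\<lambda>_. simplex_vertex l"]
    by simp
  have \<sigma>X: "\<sigma> t \<in> topspace X" if "\<sigma> \<in> topspace (simplex_space k X)" "t \<in> standard_simplex k" for \<sigma> t
    using that by (auto simp: topspace_simplex_space singular_simplex_def continuous_map_def Pi_iff)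
  have vX: "\<sigma> (simplex_vertex l) \<in> topspace X" if "\<sigma> \<in> topspace (simplex_space k X)" "l \<in> {..k}" for \<sigma> l
    using that \<sigma>X[of \<sigma> "simplex_vertex l"] by simp
  have corner: "corner t = l" if "t \<in> standard_simplex k" "l \<le> k" "2/3 \<le> t l" for t l
  proof -
    have "corner t \<le> k \<and> 2/3 \<le> t (corner t)"
      unfolding corner_def by (rule someI[of _ l]) (use that in auto)
    then show ?thesis
      using standard_simplex_pair_le[OF that(1), of "corner t" l] that(3) by fastforce
  qed
  show ?thesis
  proof (rule compact_borel_map_piecewise[where J = J and E = E and D = D
        and g = "\<lambda>c \<sigma>. restrict (g c \<sigma>) (standard_simplex m)"])
    show "finite J"
      unfolding J_def by (intro finite_PiE finite_I) auto
  next
    fix c assume c: "c \<in> J"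
    then have cI: "c l \<in> I" if "l \<le> k" for l using that by (auto simp: J_def)
    have "(\<lambda>\<sigma>. \<sigma> (simplex_vertex l)) -` {x \<in> topspace X. idx x = c l} \<inter> topspace (simplex_space k X)
        \<in> sets (simplex_borel k X)" if "l \<le> k" for l
      using vertex[OF that] idx_borel[OF cI[OF that]]
      by (intro continuous_map_preimage_sets_borel[where D = "topspace (simplex_space k X)"]) auto
    then have "(\<Inter>l\<in>{..k}. (\<lambda>\<sigma>. \<sigma> (simplex_vertex l)) -` {x \<in> topspace X. idx x = c l} \<inter> topspace (simplex_space k X))
        \<in> sets (simplex_borel k X)"
      by (intro sets.finite_INT) auto
    also have "(\<Inter>l\<in>{..k}. (\<lambda>\<sigma>. \<sigma> (simplex_vertex l)) -` {x \<in> topspace X. idx x = c l} \<inter> topspace (simplex_space k X))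
        = E c"
      using vX by (auto simp: E_def)
    finally show "E c \<in> sets (simplex_borel k X)" .
    have "closedin (simplex_space k X)
        (\<Inter>l\<in>{..k}. {\<sigma> \<in> topspace (simplex_space k X). \<sigma> (simplex_vertex l) \<in> C (c l)})"
      using vertex closedin_C cI by (intro closedin_INT closedin_continuous_map_preimage) auto
    also have "(\<Inter>l\<in>{..k}. {\<sigma> \<in> topspace (simplex_space k X). \<sigma> (simplex_vertex l) \<in> C (c l)}) = D c"
      by (auto simp: D_def)
    finally show "closedin (simplex_space k X) (D c)" .
    show "E c \<subseteq> D c"
    proof
      fix \<sigma> assume \<sigma>: "\<sigma> \<in> E c"
      have "\<sigma> (simplex_vertex l) \<in> C (c l)" if "l \<in> {..k}" for l
        using \<sigma> that idx(2)[OF vX[of \<sigma> l]] by (simp add: E_def)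
      then show "\<sigma> \<in> D c" using \<sigma> by (simp add: E_def D_def)
    qed
    fix \<sigma> assume \<sigma>: "\<sigma> \<in> E c"
    show "slide k m \<tau> s \<sigma> = restrict (g c \<sigma>) (standard_simplex m)"
      unfolding slide_def
    proof (rule restrict_ext)
      fix a assume a: "a \<in> standard_simplex m"
      show "H (idx (\<sigma> (squeeze k (s a) (\<tau> a)))) (excess k (s a) (\<tau> a)) (\<sigma> (squeeze k (s a) (\<tau> a))) = g c \<sigma> a"
      proof (cases "excess k (s a) (\<tau> a) = 0")
        case True
        then show ?thesis by (simp add: g_def H_0)
      next
        case False
        then have "3 * (1 - simplex_sq k (\<tau> a)) \<le> s a"
          using \<tau>a[OF a] s01[OF a] excess_nonzero_imp by blast
        then obtain l where l: "l \<le> k" "2/3 \<le> \<tau> a l" "squeeze k (s a) (\<tau> a) = simplex_vertex l"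
          using squeeze_corner[OF \<tau>a[OF a]] s01[OF a] by blast
        then have "corner (\<tau> a) = l" using corner \<tau>a[OF a] by blast
        then show ?thesis using \<sigma> l by (simp add: g_def E_def)
      qed
    qed
  next
    show "topspace (simplex_space k X) \<subseteq> (\<Union>c\<in>J. E c)"
    proof
      fix \<sigma> assume \<sigma>: "\<sigma> \<in> topspace (simplex_space k X)"
      then have "\<sigma> \<in> E (\<lambda>l\<in>{..k}. idx (\<sigma> (simplex_vertex l)))" by (auto simp: E_def)
      moreover have "(\<lambda>l\<in>{..k}. idx (\<sigma> (simplex_vertex l))) \<in> J"
        using idx(1)[OF vX[OF \<sigma>]] unfolding J_def by (intro restrict_PiE_iff[THEN iffD2]) blast
      ultimately show "\<sigma> \<in> (\<Union>c\<in>J. E c)" by blast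
    qed
  next
    fix c assume c: "c \<in> J"
    then have cI: "c l \<in> I" if "l \<le> k" for l using that by (auto simp: J_def)
    let ?Z = "subtopology (simplex_space k X) (D c)"
    let ?P = "prod_topology ?Z (simplex_top m)"
    let ?t = "\<lambda>p. \<tau> (snd p)" and ?s = "\<lambda>p. s (snd p)"
    have t: "continuous_map ?P (simplex_top k) ?t"
      using continuous_map_compose[OF continuous_map_snd \<tau>] by (simp add: o_def)
    have s': "continuous_map ?P (top_of_set {0..1}) ?s"
      using continuous_map_compose[OF continuous_map_snd s] by (simp add: o_def)
    then have s'': "continuous_map ?P euclideanreal ?s"
      by (simp add: continuous_map_in_subtopology)
    have fst: "continuous_map ?P (simplex_space k X) fst"
      using continuous_map_fst continuous_map_into_fulltopology by blast
    have topP: "fst p \<in> topspace (simplex_space k X)" "fst p \<in> D c" "snd p \<in> standard_simplex m"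
      if "p \<in> topspace ?P" for p
      using that by auto
    have ex: "continuous_map ?P (top_of_set {0..1}) (\<lambda>p. excess k (?s p) (?t p))"
      using continuous_map_excess[OF t s''] excess_bounds \<tau>a s01 topP(3)
      by (auto simp: continuous_map_in_subtopology)
    \<comment> \<open>A finite closed cover: on \<open>None\<close> the excess vanishes, on
      \<open>Some l\<close> the squeezed point is vertex \<open>l\<close>. Each part thus has a
      continuous formula \<open>f j\<close>, either pure squeezing or pure motion of one
      vertex.\<close>
    define part where "part = (\<lambda>j. case j of None \<Rightarrow> {p \<in> topspace ?P. ?s p - 3 * (1 - simplex_sq k (?t p)) \<in> {..0}}
       | Some l \<Rightarrow> {p \<in> topspace ?P. ?s p - 3 * (1 - simplex_sq k (?t p)) \<in> {0..}} \<inter> {p \<in> topspace ?P. ?t p l \<in> {2/3..}})"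
    define f where "f = (\<lambda>j p. case j of None \<Rightarrow> fst p (squeeze k (?s p) (?t p))
       | Some l \<Rightarrow> H (c l) (excess k (?s p) (?t p)) (fst p (simplex_vertex l)))"
    have sq: "continuous_map ?P euclideanreal (\<lambda>p. ?s p - 3 * (1 - simplex_sq k (?t p)))"
      by (intro continuous_map_diff continuous_map_real_mult continuous_map_simplex_sq t s'') auto
    have part_Some: "squeeze k (?s p) (?t p) = simplex_vertex l \<and> corner (?t p) = l"
      if "l \<le> k" "p \<in> part (Some l)" for l p
      using that squeeze_corner(2)[of "?t p" k "?s p" l] corner[of "?t p" l] \<tau>a[of "snd p"] s01[of "snd p"]
      by (auto simp: part_def)
    have gf: "g c (fst p) (snd p) = f j p"
      if "j \<in> insert None (Some ` {..k})" "p \<in> part j" for p j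
    proof (cases j)
      case None
      then have "excess k (?s p) (?t p) = 0" using that by (auto simp: part_def excess_def)
      then show ?thesis using None by (simp add: g_def f_def H_0)
    next
      case (Some l)
      then show ?thesis using that part_Some[of l p] by (auto simp: g_def f_def)
    qed
    have "continuous_map ?P X (\<lambda>p. g c (fst p) (snd p))"
    proof (rule pasting_lemma_closed[where I = "insert None (Some ` {..k})" and T = part and f = f])
      fix j assume j: "j \<in> insert None (Some ` {..k})"
      show "closedin ?P (part j)"
      proof (cases j)
        case None
        have "closedin ?P (part None)"
          unfolding part_def option.case by (rule closedin_continuous_map_preimage[OF sq]) simp
        then show ?thesis using None by simp
      next
        case (Some l)
        have "closedin ?P (part (Some l))"
          unfolding part_def option.case
          by (intro closedin_Int closedin_continuous_map_preimage[OF sq]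
              closedin_continuous_map_preimage[OF continuous_map_simplex_coordinate[OF t]]) simp_all
        then show ?thesis using Some by simp
      qed
      have "continuous_map ?P X (f j)"
      proof (cases j)
        case None
        then show ?thesis
          using continuous_map_eval_simplex[OF fst continuous_map_squeeze[OF t s'']] s01 topP(3)
          by (simp add: f_def)
      next
        case (Some l)
        then have l: "l \<le> k" using j by auto
        have "continuous_map ?P (subtopology X (C (c l))) (\<lambda>p. fst p (simplex_vertex l))"
          using continuous_map_compose[OF fst vertex[OF l]] topP(2) l
          by (auto simp: continuous_map_in_subtopology o_def D_def)
        then have "continuous_map ?P X ((\<lambda>(s, x). H (c l) s x) \<circ> (\<lambda>p. (excess k (?s p) (?t p), fst p (simplex_vertex l))))"
          by (intro continuous_map_compose[OF _ H_cont[OF cI[OF l]]] continuous_map_pairedI ex)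
        then show ?thesis using Some by (simp add: f_def o_def)
      qed
      then show "continuous_map (subtopology ?P (part j)) X (f j)"
        by (rule continuous_map_from_subtopology)
    next
      fix i j p assume "i \<in> insert None (Some ` {..k})" "j \<in> insert None (Some ` {..k})"
        "p \<in> topspace ?P \<inter> part i \<inter> part j"
      \<comment> \<open>Overlaps need no case analysis, since each formula equals \<open>g c\<close>
        on its part.\<close>
      then show "f i p = f j p" using gf[of i p] gf[of j p] by (metis IntE)
    next
      fix p assume p: "p \<in> topspace ?P"
      have "\<exists>j\<in>insert None (Some ` {..k}). p \<in> part j"
      proof (cases "?s p - 3 * (1 - simplex_sq k (?t p)) \<le> 0")
        case True
        then show ?thesis using p by (auto simp: part_def)
      next
        case False
        then obtain l where "l \<le> k" "2/3 \<le> ?t p l"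
          using squeeze_corner(1)[of "?t p" k "?s p"] \<tau>a[of "snd p"] s01[of "snd p"] topP(3)[OF p] by fastforce
        then have "p \<in> part (Some l)" using p False by (auto simp: part_def)
        then show ?thesis using \<open>l \<le> k\<close> by blast
      qed
      then show "\<exists>j. j \<in> insert None (Some ` {..k}) \<and> p \<in> part j \<and> g c (fst p) (snd p) = f j p"
        using gf by blast
    qed auto
    then show "continuous_map ?Z (simplex_space m X) (\<lambda>\<sigma>. restrict (g c \<sigma>) (standard_simplex m))"
      by (intro continuous_map_into_simplex_space) (simp add: case_prod_unfold)
  qed
qed

end

subsection \<open>Faces and the boundary operator\<close>

lemma simplical_face_simplical_face:
  "i \<le> j \<Longrightarrow> simplical_face i (simplical_face j t) = simplical_face (Suc j) (simplical_face i t)"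
  by (auto simp: simplical_face_def fun_eq_iff)

lemma continuous_map_simplical_face:
  assumes "i \<le> Suc k"
  shows "continuous_map (simplex_top k) (simplex_top (Suc k)) (simplical_face i)"
proof -
  have "continuous_map (simplex_top k) euclideanreal (\<lambda>t. t j)" for j
    using continuous_map_simplex_coordinate[of "simplex_top k" k "\<lambda>t. t"] by simp
  then have "continuous_map (simplex_top k) euclideanreal (\<lambda>t. simplical_face i t j)" for j
    by (auto simp: simplical_face_def)
  then have "continuous_map (simplex_top k) (powertop_real UNIV) (simplical_face i)"
    unfolding continuous_map_componentwise_UNIV by blast
  then show ?thesis
    using simplical_face_in_standard_simplex[of "Suc k" i] assms
    by (auto simp: continuous_map_in_subtopology)
qed

lemma compact_borel_map_singular_face:
  assumes "i \<le> Suc k"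
  shows "compact_borel_map (simplex_space (Suc k) X) (simplex_space k X) (singular_face (Suc k) i)"
proof -
  let ?P = "prod_topology (simplex_space (Suc k) X) (simplex_top k)"
  have "continuous_map ?P (simplex_top (Suc k)) (\<lambda>p. simplical_face i (snd p))"
    using continuous_map_compose[OF continuous_map_snd continuous_map_simplical_face[OF assms]]
    by (simp add: o_def)
  then have "continuous_map ?P X (\<lambda>(\<sigma>, a). (\<sigma> \<circ> simplical_face i) a)"
    using continuous_map_eval_simplex[OF continuous_map_fst] by (simp add: case_prod_unfold)
  then have "continuous_map (simplex_space (Suc k) X) (simplex_space k X)
      (\<lambda>\<sigma>. restrict (\<sigma> \<circ> simplical_face i) (standard_simplex k))"
    by (rule continuous_map_into_simplex_space)
  then show ?thesis
    by (intro continuous_imp_compact_borel_map) (simp add: singular_face_def[abs_def])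
qed

lemma singular_face_singular_face:
  assumes "i \<le> j" "j \<le> Suc k"
  shows "singular_face (Suc k) j (singular_face (Suc (Suc k)) i \<sigma>) =
         singular_face (Suc k) i (singular_face (Suc (Suc k)) (Suc j) \<sigma>)"
  using assms simplical_face_in_standard_simplex[of "Suc k" _ _]
  by (auto simp: singular_face_def restrict_def fun_eq_iff simplical_face_simplical_face)

lemma singular_face_based:
  assumes "\<sigma> \<in> based_simplices (Suc k) X x0" "i \<le> Suc k"
  shows "singular_face (Suc k) i \<sigma> \<in> based_simplices k X x0"
proof -
  have "simplical_face i (simplex_vertex l) = simplex_vertex (if l < i then l else Suc l)" for l
    by (auto simp: simplical_face_def fun_eq_iff)
  then show ?thesis
    using assms singular_simplex_singular_face[of "Suc k" X \<sigma> i]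
    by (auto simp: based_simplices_def simplicial_vertex_def singular_face_def)
qed

lemma measure_boundary_Suc:
  "measure_boundary (Suc k) X \<mu> = (\<lambda>A. \<Sum>i\<le>Suc k. (-1) ^ i *
     push_forward (simplex_borel (Suc k) X) (simplex_borel k X) (singular_face (Suc k) i) \<mu> A)"
  by (simp add: measure_boundary_def)

lemma measure_boundary_in_based_measure_chains:
  assumes "\<mu> \<in> based_measure_chains (Suc k) X x0"
  shows "measure_boundary (Suc k) X \<mu> \<in> based_measure_chains k X x0"
  using assms unfolding measure_boundary_Suc
  by (intro based_measure_chains_sum based_measure_chains_push_forward[where B = "based_simplices (Suc k) X x0"]
      compact_borel_map_singular_face singular_face_based) (auto simp: based_measure_chains_def)

text \<open>Push-forward merely evaluates on preimages, so linearity holds for arbitrary set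
  functions and can be used without proving membership in the chain spaces.\<close>

lemma measure_boundary_lincomb:
  "measure_boundary k X (\<lambda>A. a * \<mu> A + b * \<nu> A) =
     (\<lambda>A. a * measure_boundary k X \<mu> A + b * measure_boundary k X \<nu> A)"
  by (auto simp: measure_boundary_def push_forward_def fun_eq_iff sum_distrib_left
      sum.distrib[symmetric] algebra_simps intro!: sum.cong)

lemma singular_face_measurable:
  "i \<le> Suc k \<Longrightarrow> singular_face (Suc k) i \<in> measurable (simplex_borel (Suc k) X) (simplex_borel k X)"
  using compact_borel_map_singular_face by (auto simp: compact_borel_map_def)

lemma measure_boundary_boundary:
  "measure_boundary (Suc k) X (measure_boundary (Suc (Suc k)) X \<mu>) = (\<lambda>A. 0)"
proof
  fix A
  define V where "V i j = push_forward (simplex_borel (Suc (Suc k)) X) (simplex_borel k X)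
    (singular_face (Suc k) j \<circ> singular_face (Suc (Suc k)) i) \<mu> A" for i j
  have "measure_boundary (Suc k) X (measure_boundary (Suc (Suc k)) X \<mu>) A =
      (\<Sum>j\<le>Suc k. (-1) ^ j * (\<Sum>i\<le>Suc (Suc k). (-1) ^ i * V i j))"
    unfolding measure_boundary_Suc push_forward_sum V_def
    by (intro sum.cong refl arg_cong2[where f = "(*)"] fun_cong[OF push_forward_compose] singular_face_measurable)
      auto
  also have "\<dots> = (\<Sum>j\<le>Suc k. \<Sum>i\<le>Suc (Suc k). (-1) ^ (i + j) * V i j)"
    unfolding sum_distrib_left by (intro sum.cong refl) (simp add: power_add)
  also have "\<dots> = 0"
    unfolding V_def
    by (intro alternating_face_face_sum fun_cong[OF push_forward_cong]) (simp add: singular_face_singular_face)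
  finally show "measure_boundary (Suc k) X (measure_boundary (Suc (Suc k)) X \<mu>) A = 0" .
qed

subsection \<open>The prism decomposition\<close>

text \<open>The pair (\<open>degeneracy j\<close>, \<open>height j\<close>) maps the simplex of dimension \<open>k + 1\<close> affinely onto the simplex
  with vertices \<open>v\<^sub>0, \<dots>, v\<^sub>j, w\<^sub>j, \<dots>, w\<^sub>k\<close> of the prism over the standard \<open>k\<close>-simplex, where the
  \<open>v\<^sub>i\<close> have height 0 and the \<open>w\<^sub>i\<close> have height 1.\<close>

definition degeneracy :: "nat \<Rightarrow> (nat \<Rightarrow> real) \<Rightarrow> nat \<Rightarrow> real" where
  "degeneracy j a = (\<lambda>i. if i < j then a i else if i = j then a j + a (Suc j) else a (Suc i))"

definition height :: "nat \<Rightarrow> (nat \<Rightarrow> real) \<Rightarrow> real" where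
  "height j a = 1 - (\<Sum>i\<le>j. a i)"

text \<open>The induction starts at \<open>k = j\<close>, where the last image coordinate merges
  coordinates \<open>j\<close> and \<open>Suc j\<close>.\<close>

lemma sum_degeneracy:
  assumes "j \<le> k" shows "(\<Sum>i\<le>k. degeneracy j a i) = (\<Sum>i\<le>Suc k. a i)"
  using assms
proof (induction k rule: dec_induct)
  case base
  have "(\<Sum>i\<le>j. degeneracy j a i) = (\<Sum>i<j. degeneracy j a i) + degeneracy j a j"
    by (simp add: lessThan_Suc_atMost[symmetric])
  also have "(\<Sum>i<j. degeneracy j a i) = (\<Sum>i<j. a i)"
    by (intro sum.cong) (auto simp: degeneracy_def)
  finally show ?case by (simp add: degeneracy_def lessThan_Suc_atMost[symmetric])
next
  case (step k)
  then show ?case by (simp add: degeneracy_def)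
qed

lemma degeneracy_in_standard_simplex:
  assumes a: "a \<in> standard_simplex (Suc k)" and j: "j \<le> k"
  shows "degeneracy j a \<in> standard_simplex k"
  unfolding standard_simplex_def
proof (intro CollectI conjI allI impI)
  fix i
  show "0 \<le> degeneracy j a i" by (simp add: degeneracy_def standard_simplexD[OF a])
  show "degeneracy j a i \<le> 1"
    using standard_simplex_pair_le[OF a, of j "Suc j"] by (simp add: degeneracy_def standard_simplexD[OF a])
  show "degeneracy j a i = 0" if "k < i"
    using that j by (simp add: degeneracy_def standard_simplexD[OF a])
  show "(\<Sum>i\<le>k. degeneracy j a i) = 1"
    by (simp only: sum_degeneracy[OF j] standard_simplexD[OF a])
qed

lemma continuous_map_degeneracy:
  assumes "j \<le> k"
  shows "continuous_map (simplex_top (Suc k)) (simplex_top k) (degeneracy j)"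
proof -
  have "continuous_map (simplex_top (Suc k)) euclideanreal (\<lambda>a. a i)" for i
    using continuous_map_simplex_coordinate[of "simplex_top (Suc k)" "Suc k" "\<lambda>t. t"] by simp
  then have "continuous_map (simplex_top (Suc k)) euclideanreal (\<lambda>a. degeneracy j a i)" for i
    by (auto simp: degeneracy_def intro: continuous_map_add)
  then have "continuous_map (simplex_top (Suc k)) (powertop_real UNIV) (degeneracy j)"
    unfolding continuous_map_componentwise_UNIV by blast
  then show ?thesis
    using degeneracy_in_standard_simplex assms by (auto simp: continuous_map_in_subtopology)
qed

lemma height_01:
  assumes "a \<in> standard_simplex k" "j \<le> k"
  shows "0 \<le> height j a" "height j a \<le> 1"
proof -
  have "(\<Sum>i\<le>j. a i) \<le> (\<Sum>i\<le>k. a i)"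
    using assms by (intro sum_mono2) (auto simp: standard_simplexD)
  then show "0 \<le> height j a" by (simp add: height_def standard_simplexD[OF assms(1)])
  show "height j a \<le> 1" by (simp add: height_def sum_nonneg standard_simplexD[OF assms(1)])
qed

lemma continuous_map_height:
  assumes "j \<le> k"
  shows "continuous_map (simplex_top k) (top_of_set {0..1}) (height j)"
proof -
  have "continuous_map (simplex_top k) euclideanreal (\<lambda>a. a i)" for i
    using continuous_map_simplex_coordinate[of "simplex_top k" k "\<lambda>t. t"] by simp
  then have "continuous_map (simplex_top k) euclideanreal (height j)"
    unfolding height_def by (intro continuous_map_diff continuous_map_sum) auto
  then show ?thesis
    using height_01[OF _ assms] by (auto simp: continuous_map_in_subtopology)
qed

section \<open>Simplicial identities for the simplices of the prism\<close>

lemma degeneracy_face_lower: "i \<le> j \<Longrightarrow> degeneracy (Suc j) (simplical_face i a) = simplical_face i (degeneracy j a)"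
  by (auto simp: degeneracy_def simplical_face_def fun_eq_iff)

lemma degeneracy_face_upper: "j < i \<Longrightarrow> degeneracy j (simplical_face (Suc i) a) = simplical_face i (degeneracy j a)"
  by (auto simp: degeneracy_def simplical_face_def fun_eq_iff)

lemma degeneracy_face: "i = j \<or> i = Suc j \<Longrightarrow> degeneracy j (simplical_face i a) = a"
  by (auto simp: degeneracy_def simplical_face_def fun_eq_iff)

lemma height_face_lower: "i \<le> j \<Longrightarrow> height (Suc j) (simplical_face i a) = height j a"
  unfolding height_def using sum_simplical_face[of i j "\<lambda>x. x" a] by simp

lemma height_face_upper: "j < i \<Longrightarrow> height j (simplical_face i a) = height j a"
  unfolding height_def by (auto simp: simplical_face_def intro!: sum.cong)

lemma height_face_Suc: "height (Suc j) (simplical_face (Suc j) a) = height j a"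
  unfolding height_def by (simp add: simplical_face_def)

lemma height_0_face_0: "height 0 (simplical_face 0 a) = 1"
  by (simp add: height_def simplical_face_def)

lemma height_last: "a \<in> standard_simplex k \<Longrightarrow> height k a = 0"
  by (simp add: height_def standard_simplexD)

lemma degeneracy_vertex:
  "degeneracy j (simplex_vertex l) = simplex_vertex (if l \<le> j then l else l - 1)"
  by (auto simp: degeneracy_def fun_eq_iff)

lemma height_vertex: "height j (simplex_vertex l) = (if l \<le> j then 0 else 1)"
  by (simp add: height_def)

context local_contractions
begin

lemma singular_face_slide:
  "i \<le> Suc m \<Longrightarrow> singular_face (Suc m) i (slide k (Suc m) \<tau> s \<sigma>) =
     slide k m (\<tau> \<circ> simplical_face i) (s \<circ> simplical_face i) \<sigma>"
  using simplical_face_in_standard_simplex[of "Suc m" i]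
  by (auto simp: singular_face_def slide_def restrict_def fun_eq_iff)

lemma slide_cong:
  assumes "\<And>a. a \<in> standard_simplex m \<Longrightarrow> \<tau> a = \<tau>' a" "\<And>a. a \<in> standard_simplex m \<Longrightarrow> s a = s' a"
  shows "slide k m \<tau> s \<sigma> = slide k m \<tau>' s' \<sigma>"
  unfolding slide_def using assms by (intro restrict_ext) simp

text \<open>Naturality in faces: squeezing commutes with the face map and the excess is unchanged,
  so both sides evaluate \<open>\<sigma>\<close> at the same point, with the same index and
  time.\<close>

lemma slide_singular_face:
  assumes "i \<le> Suc k"
    and \<tau>: "\<And>a. a \<in> standard_simplex m \<Longrightarrow> \<tau> a \<in> standard_simplex k"
    and s: "\<And>a. a \<in> standard_simplex m \<Longrightarrow> 0 \<le> s a \<and> s a \<le> 1"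
  shows "slide k m \<tau> s (singular_face (Suc k) i \<sigma>) = slide (Suc k) m (simplical_face i \<circ> \<tau>) s \<sigma>"
  unfolding slide_def
proof (rule restrict_ext)
  fix a assume a: "a \<in> standard_simplex m"
  have "squeeze k (s a) (\<tau> a) \<in> standard_simplex k"
    using \<tau>[OF a] s[OF a] by (intro squeeze_in_standard_simplex) auto
  then have "singular_face (Suc k) i \<sigma> (squeeze k (s a) (\<tau> a)) =
      \<sigma> (squeeze (Suc k) (s a) ((simplical_face i \<circ> \<tau>) a))"
    using assms(1) \<tau>[OF a] s[OF a] by (simp add: singular_face_def squeeze_face)
  then show "H (idx (singular_face (Suc k) i \<sigma> (squeeze k (s a) (\<tau> a)))) (excess k (s a) (\<tau> a))
      (singular_face (Suc k) i \<sigma> (squeeze k (s a) (\<tau> a))) =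
    H (idx (\<sigma> (squeeze (Suc k) (s a) ((simplical_face i \<circ> \<tau>) a)))) (excess (Suc k) (s a) ((simplical_face i \<circ> \<tau>) a))
      (\<sigma> (squeeze (Suc k) (s a) ((simplical_face i \<circ> \<tau>) a)))"
    using assms(1) by (simp add: excess_face)
qed

lemma slide_0:
  assumes "singular_simplex k X \<sigma>"
  shows "slide k k (\<lambda>a. a) (\<lambda>a. 0) \<sigma> = \<sigma>"
proof -
  have "slide k k (\<lambda>a. a) (\<lambda>a. 0) \<sigma> = restrict \<sigma> (standard_simplex k)"
    unfolding slide_def by (rule restrict_ext) (simp add: squeeze_0 excess_0 H_0)
  then show ?thesis using assms by (simp add: singular_simplex_def extensional_restrict)
qed

text \<open>Squeezing fixes vertices, and there the excess is the whole time: at time 1 the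
  contraction has reached \<open>x0\<close>, at time 0 nothing has moved. That the result is a
  singular simplex is read off from measurability, since simplices are the points of the target
  space.\<close>

lemma slide_based:
  assumes \<sigma>: "singular_simplex k X \<sigma>"
    and cbm: "compact_borel_map (simplex_space k X) (simplex_space m X) (slide k m \<tau> s)"
    and vert: "\<And>i. i \<le> m \<Longrightarrow> \<exists>l\<le>k. \<tau> (simplex_vertex i) = simplex_vertex l \<and>
      (s (simplex_vertex i) = 1 \<or> s (simplex_vertex i) = 0 \<and> \<sigma> (simplex_vertex l) = x0)"
  shows "slide k m \<tau> s \<sigma> \<in> based_simplices m X x0"
proof -
  have "slide k m \<tau> s \<sigma> \<in> space (simplex_borel m X)"
    using cbm \<sigma> unfolding compact_borel_map_def
    by (intro measurable_space[of "slide k m \<tau> s" "simplex_borel k X"]) (auto simp: topspace_simplex_space)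
  moreover have "slide k m \<tau> s \<sigma> (simplex_vertex i) = x0" if i: "i \<le> m" for i
  proof -
    obtain l where l: "l \<le> k" "\<tau> (simplex_vertex i) = simplex_vertex l"
      and s: "s (simplex_vertex i) = 1 \<or> s (simplex_vertex i) = 0 \<and> \<sigma> (simplex_vertex l) = x0"
      using vert[OF i] by blast
    have "\<sigma> (simplex_vertex l) \<in> topspace X"
      using \<sigma> l(1) by (auto simp: singular_simplex_def continuous_map_def Pi_iff)
    then have "H (idx (\<sigma> (simplex_vertex l))) (s (simplex_vertex i)) (\<sigma> (simplex_vertex l)) = x0"
      using s H_0 H_1 idx by auto
    then show ?thesis
      using i l s by (auto simp: slide_def squeeze_vertex excess_vertex)
  qed
  ultimately show ?thesis
    by (simp add: based_simplices_def simplicial_vertex_def topspace_simplex_space)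
qed

definition prism :: "nat \<Rightarrow> nat \<Rightarrow> ((nat \<Rightarrow> real) \<Rightarrow> 'a) \<Rightarrow> (nat \<Rightarrow> real) \<Rightarrow> 'a" where
  "prism k j = slide k (Suc k) (degeneracy j) (height j)"

text \<open>The homotopy \<open>G\<close> of the overview: the classical prism operator, with
  sliding in place of a homotopy of the whole space.\<close>

definition prism_op :: "nat \<Rightarrow> 'a measure_chain \<Rightarrow> 'a measure_chain" where
  "prism_op k \<mu> = (\<lambda>A. \<Sum>j\<le>k. (-1) ^ j * push_forward (simplex_borel k X) (simplex_borel (Suc k) X) (prism k j) \<mu> A)"

text \<open>The map \<open>F\<close> of the overview.\<close>

definition slide_op :: "nat \<Rightarrow> 'a measure_chain \<Rightarrow> 'a measure_chain" where
  "slide_op k \<mu> = push_forward (simplex_borel k X) (simplex_borel k X) (slide k k (\<lambda>a. a) (\<lambda>a. 1)) \<mu>"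

lemma compact_borel_map_prism:
  "j \<le> k \<Longrightarrow> compact_borel_map (simplex_space k X) (simplex_space (Suc k) X) (prism k j)"
  unfolding prism_def
  by (intro compact_borel_map_slide continuous_map_degeneracy continuous_map_height) auto

lemma compact_borel_map_slide_1:
  "compact_borel_map (simplex_space k X) (simplex_space k X) (slide k k (\<lambda>a. a) (\<lambda>a. 1))"
  by (intro compact_borel_map_slide) (auto simp: continuous_map_in_subtopology)

lemma prism_op_in_measure_chains:
  "\<mu> \<in> measure_chains k X \<Longrightarrow> prism_op k \<mu> \<in> measure_chains (Suc k) X"
  unfolding prism_op_def
  by (intro measure_chains_sum measure_chains_push_forward compact_borel_map_prism) auto

text \<open>The contraction may drag \<open>x0\<close> around a nontrivial loop, but vertices of the
  prism have height 0 or 1 only, where the loop is at \<open>x0\<close>.\<close>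

lemma prism_based:
  assumes "\<sigma> \<in> based_simplices k X x0" "j \<le> k"
  shows "prism k j \<sigma> \<in> based_simplices (Suc k) X x0"
  unfolding prism_def
proof (rule slide_based)
  show "compact_borel_map (simplex_space k X) (simplex_space (Suc k) X) (slide k (Suc k) (degeneracy j) (height j))"
    using compact_borel_map_prism[OF assms(2)] by (simp add: prism_def)
  show "\<exists>l\<le>k. degeneracy j (simplex_vertex i) = simplex_vertex l \<and>
      (height j (simplex_vertex i) = 1 \<or> height j (simplex_vertex i) = 0 \<and> \<sigma> (simplex_vertex l) = x0)"
    if "i \<le> Suc k" for i
    unfolding degeneracy_vertex height_vertex
    using that assms by (intro exI[of _ "if i \<le> j then i else i - 1"]) (auto simp: based_simplices_def simplicial_vertex_def)
qed (use assms in \<open>auto simp: based_simplices_def\<close>)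

lemma prism_op_in_based_measure_chains:
  "\<mu> \<in> based_measure_chains k X x0 \<Longrightarrow> prism_op k \<mu> \<in> based_measure_chains (Suc k) X x0"
  unfolding prism_op_def
  by (intro based_measure_chains_sum based_measure_chains_push_forward[where B = "based_simplices k X x0"]
      compact_borel_map_prism prism_based) (auto simp: based_measure_chains_def)

lemma slide_op_in_based_measure_chains:
  assumes "\<mu> \<in> measure_chains k X"
  shows "slide_op k \<mu> \<in> based_measure_chains k X x0"
  unfolding slide_op_def
proof (rule based_measure_chains_push_forward[OF assms _ compact_borel_map_slide_1])
  show "vanishes_off (simplex_borel k X) \<mu> UNIV"
    using assms by (auto simp: vanishes_off_def measure_chains_iff finite_signed_measure_def)
  show "slide k k (\<lambda>a. a) (\<lambda>a. 1) \<sigma> \<in> based_simplices k X x0" if "singular_simplex k X \<sigma>" for \<sigma>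
    using that compact_borel_map_slide_1 by (rule slide_based) auto
qed

lemma prism_op_lincomb:
  "prism_op k (\<lambda>A. a * \<mu> A + b * \<nu> A) = (\<lambda>A. a * prism_op k \<mu> A + b * prism_op k \<nu> A)"
  by (auto simp: prism_op_def push_forward_def fun_eq_iff sum_distrib_left
      sum.distrib[symmetric] algebra_simps intro!: sum.cong)

lemma prism_measurable:
  "j \<le> k \<Longrightarrow> prism k j \<in> measurable (simplex_borel k X) (simplex_borel (Suc k) X)"
  using compact_borel_map_prism by (auto simp: compact_borel_map_def)

lemma boundary_prism_op:
  "measure_boundary (Suc k) X (prism_op k \<mu>) A = (\<Sum>i\<le>Suc k. \<Sum>j\<le>k. (-1) ^ (i + j) *
     push_forward (simplex_borel k X) (simplex_borel k X) (singular_face (Suc k) i \<circ> prism k j) \<mu> A)"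
proof -
  have "measure_boundary (Suc k) X (prism_op k \<mu>) A = (\<Sum>i\<le>Suc k. (-1) ^ i * (\<Sum>j\<le>k. (-1) ^ j *
     push_forward (simplex_borel k X) (simplex_borel k X) (singular_face (Suc k) i \<circ> prism k j) \<mu> A))"
    unfolding measure_boundary_Suc prism_op_def push_forward_sum
    by (intro sum.cong refl arg_cong2[where f = "(*)"] fun_cong[OF push_forward_compose]
        singular_face_measurable prism_measurable) auto
  then show ?thesis by (simp add: sum_distrib_left power_add mult.assoc)
qed

lemma prism_op_boundary:
  "prism_op k (measure_boundary (Suc k) X \<mu>) A = (\<Sum>i\<le>Suc k. \<Sum>j\<le>k. (-1) ^ (i + j) *
     push_forward (simplex_borel (Suc k) X) (simplex_borel (Suc k) X) (prism k j \<circ> singular_face (Suc k) i) \<mu> A)"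
proof -
  have "prism_op k (measure_boundary (Suc k) X \<mu>) A = (\<Sum>j\<le>k. (-1) ^ j * (\<Sum>i\<le>Suc k. (-1) ^ i *
     push_forward (simplex_borel (Suc k) X) (simplex_borel (Suc k) X) (prism k j \<circ> singular_face (Suc k) i) \<mu> A))"
    unfolding measure_boundary_Suc prism_op_def push_forward_sum
    by (intro sum.cong refl arg_cong2[where f = "(*)"] fun_cong[OF push_forward_compose]
        singular_face_measurable prism_measurable) auto
  also have "\<dots> = (\<Sum>j\<le>k. \<Sum>i\<le>Suc k. (-1) ^ (i + j) *
     push_forward (simplex_borel (Suc k) X) (simplex_borel (Suc k) X) (prism k j \<circ> singular_face (Suc k) i) \<mu> A)"
    unfolding sum_distrib_left by (intro sum.cong refl) (simp add: power_add)
  finally show ?thesis by (subst sum.swap)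
qed

lemma singular_face_prism:
  assumes "i \<le> Suc k"
  shows "singular_face (Suc k) i (prism k j \<sigma>) =
    slide k k (degeneracy j \<circ> simplical_face i) (height j \<circ> simplical_face i) \<sigma>"
  using assms by (simp add: prism_def singular_face_slide)

lemma prism_singular_face:
  assumes "i \<le> Suc k" "j \<le> k"
  shows "prism k j (singular_face (Suc k) i \<sigma>) = slide (Suc k) (Suc k) (simplical_face i \<circ> degeneracy j) (height j) \<sigma>"
  unfolding prism_def
  using assms degeneracy_in_standard_simplex height_01[of _ "Suc k" j]
  by (intro slide_singular_face) auto

lemma bottom_face_prism:
  assumes "singular_simplex k X \<sigma>"
  shows "singular_face (Suc k) (Suc k) (prism k k \<sigma>) = \<sigma>"
proof -
  have "singular_face (Suc k) (Suc k) (prism k k \<sigma>) = slide k k (\<lambda>a. a) (\<lambda>a. 0) \<sigma>"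
    unfolding singular_face_prism[OF order_refl]
    by (rule slide_cong) (simp_all add: degeneracy_face height_face_upper height_last)
  then show ?thesis using slide_0[OF assms] by simp
qed

lemma top_face_prism: "singular_face (Suc k) 0 (prism k 0 \<sigma>) = slide k k (\<lambda>a. a) (\<lambda>a. 1) \<sigma>"
  unfolding singular_face_prism[OF le0]
  by (rule slide_cong) (simp_all add: degeneracy_face height_0_face_0)

text \<open>Consecutive simplices of the prism share this face, which makes the two diagonals of the
  double sum cancel.\<close>

lemma middle_face_prism:
  "j < k \<Longrightarrow> singular_face (Suc k) (Suc j) (prism k j \<sigma>) = singular_face (Suc k) (Suc j) (prism k (Suc j) \<sigma>)"
  by (subst (1 2) singular_face_prism)
    (auto intro!: slide_cong simp: degeneracy_face height_face_Suc height_face_upper)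

lemma push_forward_top_bottom:
  assumes "\<mu> \<in> measure_chains k X"
  shows "push_forward (simplex_borel k X) (simplex_borel k X) (singular_face (Suc k) 0 \<circ> prism k 0) \<mu> = slide_op k \<mu>"
    and "push_forward (simplex_borel k X) (simplex_borel k X) (singular_face (Suc k) (Suc k) \<circ> prism k k) \<mu> = \<mu>"
proof -
  show "push_forward (simplex_borel k X) (simplex_borel k X) (singular_face (Suc k) 0 \<circ> prism k 0) \<mu> = slide_op k \<mu>"
    unfolding slide_op_def by (rule push_forward_cong) (simp add: top_face_prism)
  show "push_forward (simplex_borel k X) (simplex_borel k X) (singular_face (Suc k) (Suc k) \<circ> prism k k) \<mu> = \<mu>"
    using assms by (intro push_forward_id) (auto simp: measure_chains_iff topspace_simplex_space bottom_face_prism)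
qed

lemma prism_op_homotopy_0:
  assumes "\<mu> \<in> measure_chains 0 X"
  shows "measure_boundary (Suc 0) X (prism_op 0 \<mu>) A = slide_op 0 \<mu> A - \<mu> A"
  using push_forward_top_bottom[OF assms] by (simp add: boundary_prism_op)

lemma prism_op_homotopy_Suc:
  assumes "\<mu> \<in> measure_chains (Suc k) X"
  shows "measure_boundary (Suc (Suc k)) X (prism_op (Suc k) \<mu>) A + prism_op k (measure_boundary (Suc k) X \<mu>) A
     = slide_op (Suc k) \<mu> A - \<mu> A"
proof -
  define T where "T i j = push_forward (simplex_borel (Suc k) X) (simplex_borel (Suc k) X)
    (singular_face (Suc (Suc k)) i \<circ> prism (Suc k) j) \<mu> A" for i j
  define U where "U i j = push_forward (simplex_borel (Suc k) X) (simplex_borel (Suc k) X)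
    (prism k j \<circ> singular_face (Suc k) i) \<mu> A" for i j
  have "(\<Sum>i\<le>Suc (Suc k). \<Sum>j\<le>Suc k. (-1) ^ (i + j) * T i j) + (\<Sum>i\<le>Suc k. \<Sum>j\<le>k. (-1) ^ (i + j) * U i j)
         = T 0 0 - T (Suc (Suc k)) (Suc k)"
  proof (rule alternating_prism_sum)
    fix i j assume ij: "i \<le> j" "j \<le> k"
    then show "T i (Suc j) = U i j"
      unfolding T_def U_def
      by (intro fun_cong[OF push_forward_cong])
        (auto simp: singular_face_prism prism_singular_face degeneracy_face_lower height_face_lower intro!: slide_cong)
  next
    fix i j assume ij: "j < i" "i \<le> Suc k"
    then show "T (Suc i) j = U i j"
      unfolding T_def U_def
      by (intro fun_cong[OF push_forward_cong])
        (auto simp: singular_face_prism prism_singular_face degeneracy_face_upper height_face_upper intro!: slide_cong)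
  next
    fix j assume "j \<le> k"
    then show "T (Suc j) j = T (Suc j) (Suc j)"
      unfolding T_def by (intro fun_cong[OF push_forward_cong]) (simp add: middle_face_prism)
  qed
  then show ?thesis
    unfolding boundary_prism_op prism_op_boundary
    by (simp only: T_def U_def push_forward_top_bottom[OF assms])
qed

end

subsection \<open>The chain map and the chain homotopy\<close>

text \<open>A subspace has a linear complement. The projection is defined on all functions, not just
  on chains, so that its linearity carries no side conditions.\<close>

lemma linear_projection_exists:
  fixes W :: "('b \<Rightarrow> real) set"
  assumes zero: "(\<lambda>x. 0) \<in> W"
    and add: "\<And>f g. f \<in> W \<Longrightarrow> g \<in> W \<Longrightarrow> (\<lambda>x. f x + g x) \<in> W"
    and cmult: "\<And>c f. f \<in> W \<Longrightarrow> (\<lambda>x. c * f x) \<in> W"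
  obtains P :: "('b \<Rightarrow> real) \<Rightarrow> 'b \<Rightarrow> real"
  where "\<And>f. P f \<in> W" "\<And>f. f \<in> W \<Longrightarrow> P f = f"
    "\<And>a b f g. P (\<lambda>x. a * f x + b * g x) = (\<lambda>x. a * P f x + b * P g x)"
proof -
  let ?scale = "\<lambda>(c::real) (f::'b \<Rightarrow> real) x. c * f x"
  interpret V: vector_space ?scale
    by unfold_locales (auto simp: fun_eq_iff algebra_simps)
  interpret VV: vector_space_pair ?scale ?scale ..
  have "V.subspace W"
    unfolding V.subspace_def using assms by (auto simp: zero_fun_def plus_fun_def)
  then obtain P where P: "range P \<subseteq> W" "Vector_Spaces.linear ?scale ?scale P" "\<forall>f\<in>W. P f = f"
    using VV.linear_exists_left_inverse_on[OF V.linear_ident, of W] by auto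
  interpret P: Vector_Spaces.linear ?scale ?scale P by (rule P(2))
  have "P (\<lambda>x. a * f x + b * g x) = (\<lambda>x. a * P f x + b * P g x)" for a b f g
    using P.add[of "\<lambda>x. a * f x" "\<lambda>x. b * g x"] P.scale[of a f] P.scale[of b g]
    by (simp add: plus_fun_def)
  with P show ?thesis by (intro that[of P]) auto
qed

lemma real_linear_betweenI:
  assumes "f \<in> V \<rightarrow> W"
    and lin: "\<And>a b \<mu> \<nu>. f (\<lambda>A. a * \<mu> A + b * \<nu> A) = (\<lambda>A. a * f \<mu> A + b * f \<nu> A)"
  shows "real_linear_between V W f"
  unfolding real_linear_between_def
proof (intro conjI ballI allI)
  fix \<mu> \<nu>
  show "f (\<lambda>A. \<mu> A + \<nu> A) = (\<lambda>A. f \<mu> A + f \<nu> A)" using lin[of 1 \<mu> 1 \<nu>] by simp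
next
  fix c \<mu>
  show "f (\<lambda>A. c * \<mu> A) = (\<lambda>A. c * f \<mu> A)" using lin[of c \<mu> 0 \<mu>] by simp
qed (rule assms(1))

lemma measure_chains_diff:
  "\<mu> \<in> measure_chains k X \<Longrightarrow> \<nu> \<in> measure_chains k X \<Longrightarrow> (\<lambda>A. \<mu> A - \<nu> A) \<in> measure_chains k X"
  using measure_chains_add[OF _ measure_chains_cmult[of \<nu> k X "-1"]] by simp

lemma based_measure_chains_diff:
  "\<mu> \<in> based_measure_chains k X x0 \<Longrightarrow> \<nu> \<in> based_measure_chains k X x0 \<Longrightarrow>
     (\<lambda>A. \<mu> A - \<nu> A) \<in> based_measure_chains k X x0"
  using based_measure_chains_add[OF _ based_measure_chains_cmult[of \<nu> k X x0 "-1"]] by simp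

lemma measure_boundary_diff:
  "measure_boundary k X (\<lambda>A. \<mu> A - \<nu> A) = (\<lambda>A. measure_boundary k X \<mu> A - measure_boundary k X \<nu> A)"
  using measure_boundary_lincomb[of k X 1 \<mu> "-1" \<nu>] by simp

lemma measure_boundary_add:
  "measure_boundary k X (\<lambda>A. \<mu> A + \<nu> A) = (\<lambda>A. measure_boundary k X \<mu> A + measure_boundary k X \<nu> A)"
  using measure_boundary_lincomb[of k X 1 \<mu> 1 \<nu>] by simp

context local_contractions
begin

lemma prism_op_diff:
  "prism_op k (\<lambda>A. \<mu> A - \<nu> A) = (\<lambda>A. prism_op k \<mu> A - prism_op k \<nu> A)"
  using prism_op_lincomb[of k 1 \<mu> "-1" \<nu>] by simp

theorem based_chain_retraction:
  "\<exists>\<eta> s. based_chain_map X x0 \<eta> \<and>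
     (\<forall>k. \<forall>\<mu>\<in>based_measure_chains k X x0. \<eta> k \<mu> = \<mu>) \<and>
     measure_chain_homotopy X \<eta> (\<lambda>k \<mu>. \<mu>) s"
proof -
  let ?proj = "\<lambda>k (P :: 'a measure_chain \<Rightarrow> 'a measure_chain).
      (\<forall>\<mu>. P \<mu> \<in> based_measure_chains k X x0) \<and> (\<forall>\<mu>. \<mu> \<in> based_measure_chains k X x0 \<longrightarrow> P \<mu> = \<mu>) \<and>
      (\<forall>a b \<mu> \<nu>. P (\<lambda>A. a * \<mu> A + b * \<nu> A) = (\<lambda>A. a * P \<mu> A + b * P \<nu> A))"
  have "\<exists>P. ?proj k P" for k
  proof (rule linear_projection_exists[OF based_measure_chains_zero[of k X x0]
        based_measure_chains_add based_measure_chains_cmult])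
    fix P :: "'a measure_chain \<Rightarrow> 'a measure_chain"
    assume "\<And>\<mu>. P \<mu> \<in> based_measure_chains k X x0"
      "\<And>\<mu>. \<mu> \<in> based_measure_chains k X x0 \<Longrightarrow> P \<mu> = \<mu>"
      "\<And>a b \<mu> \<nu>. P (\<lambda>A. a * \<mu> A + b * \<nu> A) = (\<lambda>A. a * P \<mu> A + b * P \<nu> A)"
    then show "\<exists>P. ?proj k P" by (intro exI[of _ P] conjI allI impI) assumption+
  qed
  then have "\<exists>P. \<forall>k. ?proj k (P k)" by (intro choice allI)
  then obtain P :: "nat \<Rightarrow> 'a measure_chain \<Rightarrow> 'a measure_chain" where "\<forall>k. ?proj k (P k)" ..
  then have P: "\<And>k \<mu>. P k \<mu> \<in> based_measure_chains k X x0"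
    and P_id: "\<And>k \<mu>. \<mu> \<in> based_measure_chains k X x0 \<Longrightarrow> P k \<mu> = \<mu>"
    and P_lin: "\<And>k a b \<mu> \<nu>. P k (\<lambda>A. a * \<mu> A + b * \<nu> A) = (\<lambda>A. a * P k \<mu> A + b * P k \<nu> A)"
    by simp_all
  have PC: "P k \<mu> \<in> measure_chains k X" for k \<mu>
    using P[of k \<mu>] by (simp add: based_measure_chains_def)
  define D where "D k \<mu> = (\<lambda>A. \<mu> A - P k \<mu> A)" for k \<mu>
  define s where "s k \<mu> = prism_op k (D k \<mu>)" for k \<mu>
  \<comment> \<open>The term "s after boundary", with value 0 in degree 0; it allows one formula for
    \<open>\<eta>\<close> in all degrees.\<close>
  define sb where "sb k \<mu> = (case k of 0 \<Rightarrow> (\<lambda>A. 0) | Suc l \<Rightarrow> s l (measure_boundary k X \<mu>))" for k \<mu>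
  define \<eta> where "\<eta> k \<mu> = (\<lambda>A. \<mu> A + measure_boundary (Suc k) X (s k \<mu>) A + sb k \<mu> A)" for k \<mu>
  have D: "D k \<mu> \<in> measure_chains k X" if "\<mu> \<in> measure_chains k X" for k \<mu>
    unfolding D_def using that PC by (rule measure_chains_diff)
  have s: "s k \<mu> \<in> measure_chains (Suc k) X" if "\<mu> \<in> measure_chains k X" for k \<mu>
    unfolding s_def using D[OF that] by (rule prism_op_in_measure_chains)
  have s_lin: "s k (\<lambda>A. a * \<mu> A + b * \<nu> A) = (\<lambda>A. a * s k \<mu> A + b * s k \<nu> A)" for k a b \<mu> \<nu>
    unfolding s_def D_def prism_op_diff P_lin prism_op_lincomb by (simp add: algebra_simps)
  have sb_lin: "sb k (\<lambda>A. a * \<mu> A + b * \<nu> A) = (\<lambda>A. a * sb k \<mu> A + b * sb k \<nu> A)" for k a b \<mu> \<nu>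
    by (simp add: sb_def measure_boundary_lincomb s_lin split: nat.split)
  have s_0: "s k (\<lambda>A. 0) = (\<lambda>A. 0)" for k
    using s_lin[of k 0 "\<lambda>A. 0" 0 "\<lambda>A. 0"] by simp
  have \<eta>_lin: "\<eta> k (\<lambda>A. a * \<mu> A + b * \<nu> A) = (\<lambda>A. a * \<eta> k \<mu> A + b * \<eta> k \<nu> A)" for k a b \<mu> \<nu>
    unfolding \<eta>_def s_lin sb_lin measure_boundary_lincomb by (simp add: algebra_simps)
  have s_based: "s k \<mu> = (\<lambda>A. 0)" if "\<mu> \<in> based_measure_chains k X x0" for k \<mu>
    using prism_op_lincomb[of k 0 \<mu> 0 \<mu>] that by (simp add: s_def D_def P_id)
  have \<eta>_based: "\<eta> k \<mu> \<in> based_measure_chains k X x0" if \<mu>: "\<mu> \<in> measure_chains k X" for k \<mu>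
  proof (cases k)
    case 0
    have "\<eta> k \<mu> = (\<lambda>A. slide_op 0 (D 0 \<mu>) A + P 0 \<mu> A)"
      using prism_op_homotopy_0[of "D 0 \<mu>"] D[of \<mu> 0] \<mu> 0
      by (simp add: \<eta>_def s_def sb_def D_def fun_eq_iff)
    then show ?thesis
      using slide_op_in_based_measure_chains[OF D[OF \<mu>]] P 0 by (auto intro: based_measure_chains_add)
  next
    case (Suc l)
    \<comment> \<open>The homotopy formula is applied to \<open>D k \<mu>\<close> alone. The last
      two terms measure how far \<open>P\<close> is from commuting with the boundary; they need not
      cancel, but each is \<open>prism_op\<close> of a based chain.\<close>
    have "\<eta> k \<mu> A = slide_op k (D k \<mu>) A + P k \<mu> A +
        (prism_op l (measure_boundary k X (P k \<mu>)) A - prism_op l (P l (measure_boundary k X \<mu>)) A)" for A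
    proof -
      have "measure_boundary (Suc k) X (s k \<mu>) A =
          slide_op k (D k \<mu>) A - D k \<mu> A - prism_op l (measure_boundary k X (D k \<mu>)) A"
        using prism_op_homotopy_Suc[of "D k \<mu>" l A] D[OF \<mu>] Suc by (simp add: s_def algebra_simps)
      moreover have "sb k \<mu> A = prism_op l (measure_boundary k X \<mu>) A - prism_op l (P l (measure_boundary k X \<mu>)) A"
        using Suc by (simp add: sb_def s_def D_def prism_op_diff)
      moreover have "prism_op l (measure_boundary k X (D k \<mu>)) A =
          prism_op l (measure_boundary k X \<mu>) A - prism_op l (measure_boundary k X (P k \<mu>)) A"
        by (simp add: D_def measure_boundary_diff prism_op_diff)
      moreover have "D k \<mu> A = \<mu> A - P k \<mu> A" by (simp add: D_def)
      ultimately show ?thesis by (simp add: \<eta>_def)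
    qed
    moreover have "measure_boundary k X (P k \<mu>) \<in> based_measure_chains l X x0"
      using measure_boundary_in_based_measure_chains[of "P k \<mu>" l X x0] P Suc by simp
    then have "(\<lambda>A. slide_op k (D k \<mu>) A + P k \<mu> A +
        (prism_op l (measure_boundary k X (P k \<mu>)) A - prism_op l (P l (measure_boundary k X \<mu>)) A))
        \<in> based_measure_chains k X x0"
      using slide_op_in_based_measure_chains[OF D[OF \<mu>]] P Suc
      by (intro based_measure_chains_add based_measure_chains_diff)
        (auto intro: prism_op_in_based_measure_chains)
    ultimately show ?thesis by presburger
  qed
  show ?thesis
  proof (intro exI conjI allI ballI)
    show "based_chain_map X x0 \<eta>"
      unfolding based_chain_map_def
    proof (intro conjI allI ballI)
      show "real_linear_between (measure_chains k X) (based_measure_chains k X x0) (\<eta> k)" for k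
        using \<eta>_based \<eta>_lin by (intro real_linear_betweenI) auto
      show "measure_boundary (Suc k) X (\<eta> (Suc k) \<mu>) = \<eta> k (measure_boundary (Suc k) X \<mu>)" for k \<mu>
      proof -
        \<comment> \<open>As boundaries square to zero, both sides reduce to the boundary of \<mu>
          plus the boundary of \<open>s\<close> of that boundary.\<close>
        have "sb k (measure_boundary (Suc k) X \<mu>) = (\<lambda>A. 0)"
          by (cases k) (simp_all add: sb_def measure_boundary_boundary s_0)
        then show ?thesis
          by (simp add: \<eta>_def measure_boundary_add measure_boundary_boundary) (simp add: sb_def)
      qed
    qed
    show "\<eta> k \<mu> = \<mu>" if "\<mu> \<in> based_measure_chains k X x0" for k \<mu>
    proof -
      \<comment> \<open>The boundary of a based chain is based, and \<open>s\<close> kills based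
        chains.\<close>
      have "sb k \<mu> = (\<lambda>A. 0)"
        using that measure_boundary_in_based_measure_chains[of \<mu> _ X x0]
        by (cases k) (simp_all add: sb_def s_based)
      moreover have "measure_boundary (Suc k) X (\<lambda>A. 0) = (\<lambda>A. 0)"
        using measure_boundary_diff[of "Suc k" X "\<lambda>A. 0" "\<lambda>A. 0"] by simp
      ultimately show ?thesis using that by (simp add: \<eta>_def s_based)
    qed
    show "measure_chain_homotopy X \<eta> (\<lambda>k \<mu>. \<mu>) s"
      unfolding measure_chain_homotopy_def
    proof (intro conjI allI ballI)
      show "real_linear_between (measure_chains k X) (measure_chains (Suc k) X) (s k)" for k
        using s s_lin by (intro real_linear_betweenI) auto
    qed (simp_all add: \<eta>_def sb_def)
  qed
qed

end

theorem lemma5p2: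
  fixes X :: "'a topology" and n :: nat and U :: "nat \<Rightarrow> 'a set" and x0 :: 'a
  assumes "path_connected_space X"
    and "topspace X = (\<Union>i\<in>{1..n}. U i)"
    and "\<And>i. i \<in> {1..n} \<Longrightarrow> U i \<in> sets (borel_space_of X)"
    and "\<And>i. i \<in> {1..n} \<Longrightarrow> compactin X (X closure_of U i)"
    and "\<And>i. i \<in> {1..n} \<Longrightarrow> contractible_in X (X closure_of U i)"
    and "x0 \<in> topspace X"
  shows "\<exists>\<eta> s. based_chain_map X x0 \<eta> \<and>
           (\<forall>k. \<forall>\<mu>\<in>based_measure_chains k X x0. \<eta> k \<mu> = \<mu>) \<and>
           measure_chain_homotopy X \<eta> (\<lambda>k \<mu>. \<mu>) s"
proof -
  define idx where "idx x = (LEAST i. i \<in> {1..n} \<and> x \<in> U i)" for x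
  have idx: "idx x \<in> {1..n} \<and> x \<in> U (idx x)" if "x \<in> topspace X" for x
    using that assms(2) LeastI_ex[of "\<lambda>i. i \<in> {1..n} \<and> x \<in> U i"] unfolding idx_def by blast
  have UX: "U i \<subseteq> topspace X" if "i \<in> {1..n}" for i
    using assms(2) that by auto
  have idx_borel: "{x \<in> topspace X. idx x = i} \<in> sets (borel_space_of X)" if i: "i \<in> {1..n}" for i
  proof -
    \<comment> \<open>Choosing the least index makes the cover disjoint using finitely many Borel
      operations.\<close>
    have "{x \<in> topspace X. idx x = i} = U i - (\<Union>j\<in>{1..<i}. U j)"
    proof (rule Set.set_eqI)
      fix x
      have "idx x = i \<longleftrightarrow> (\<forall>j\<in>{1..<i}. x \<notin> U j)" if "x \<in> U i"
      proof
        assume "idx x = i"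
        then show "\<forall>j\<in>{1..<i}. x \<notin> U j"
          using i not_less_Least[of _ "\<lambda>i. i \<in> {1..n} \<and> x \<in> U i"] by (auto simp: idx_def)
      next
        assume "\<forall>j\<in>{1..<i}. x \<notin> U j"
        then show "idx x = i"
          unfolding idx_def using i that by (intro Least_equality) (auto simp: not_le[symmetric])
      qed
      then show "x \<in> {x \<in> topspace X. idx x = i} \<longleftrightarrow> x \<in> U i - (\<Union>j\<in>{1..<i}. U j)"
        using UX[OF i] idx[of x] by auto
    qed
    also have "\<dots> \<in> sets (borel_space_of X)"
      using i assms(3) by (intro sets.Diff sets.finite_UN) auto
    finally show ?thesis .
  qed
  have "\<exists>h. continuous_map (prod_topology (top_of_set {0..1}) (subtopology X (X closure_of U i))) X h \<and>
      (\<forall>x. h (0::real, x) = x) \<and> (\<forall>x. h (1, x) = x0)" if i: "i \<in> {1..n}" for i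
  proof -
    obtain c where c: "c \<in> topspace X"
      "homotopic_with (\<lambda>h. True) (subtopology X (X closure_of U i)) X id (\<lambda>x. c)"
      using assms(5)[OF i] by (auto simp: contractible_in_def)
    \<comment> \<open>The end point \<open>c\<close> depends on \<open>i\<close>; a path from
      \<open>c\<close> to \<open>x0\<close> makes all contractions end at the same point.\<close>
    have "homotopic_with (\<lambda>h. True) (subtopology X (X closure_of U i)) X (\<lambda>x. c) (\<lambda>x. x0)"
      using assms(1,6) c(1) by (simp add: homotopic_constant_maps path_connected_space_iff_path_component)
    then have "homotopic_with (\<lambda>h. True) (subtopology X (X closure_of U i)) X id (\<lambda>x. x0)"
      using c(2) homotopic_with_trans by blast
    then show ?thesis by (auto simp: homotopic_with_def)
  qed
  then have "\<exists>h :: nat \<Rightarrow> real \<times> 'a \<Rightarrow> 'a. \<forall>i\<in>{1..n}.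
      continuous_map (prod_topology (top_of_set {0..1}) (subtopology X (X closure_of U i))) X (h i) \<and>
      (\<forall>x. h i (0::real, x) = x) \<and> (\<forall>x. h i (1, x) = x0)"
    by (intro bchoice ballI)
  then obtain h :: "nat \<Rightarrow> real \<times> 'a \<Rightarrow> 'a" where h: "\<forall>i\<in>{1..n}.
      continuous_map (prod_topology (top_of_set {0..1}) (subtopology X (X closure_of U i))) X (h i) \<and>
      (\<forall>x. h i (0, x) = x) \<and> (\<forall>x. h i (1, x) = x0)" ..
  \<comment> \<open>Standing still for foreign indices secures the unconditional start value
    required by the locale.\<close>
  define H where "H i t x = (if i \<in> {1..n} then h i (t, x) else x)" for i and t :: real and x
  interpret local_contractions X "{1..n}" "\<lambda>i. X closure_of U i" idx H x0
  proof
    show "x \<in> X closure_of U (idx x)" if "x \<in> topspace X" for x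
      using idx[OF that] closure_of_subset[OF UX, of "idx x"] by (meson subsetD)
    show "continuous_map (prod_topology (top_of_set {0..1}) (subtopology X (X closure_of U i))) X (\<lambda>(s, x). H i s x)"
      if "i \<in> {1..n}" for i
      using h that by (simp add: H_def case_prod_unfold)
    show "H i 1 x = x0" if "i \<in> {1..n}" for i x
      using h that by (simp add: H_def)
    show "H i 0 x = x" for i x
      using h by (simp add: H_def)
    show "idx x \<in> {1..n}" if "x \<in> topspace X" for x
      using idx[OF that] by (rule conjunct1)
  qed (fact idx_borel | simp)+
  show ?thesis by (rule based_chain_retraction)
qed

end
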